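(* Let $n\ge2$ and $\beta_0<\beta_2<\beta_1$. The shape process $H^k$ is ergodic for every $2\le k\le n+2$ if either (a) $\beta_2>n\beta_0$, or (b) $\beta_2>\frac{(n-1)\beta_1+\beta_0}{n}$. Moreover, if (c) $\beta_2>4\sqrt2\sqrt{\beta_1\beta_0}$, then $H^k$ is ergodic for every $k\ge2$.
   Context: For $k\ge2$ and $\beta=(\beta_0,\beta_1,\beta_2)\in(0,\infty)^3$: for $x\in\mathbb{N}^k$, with zero boundary convention $x(0)=x(k+1)=0$, let $V_j(x)=\mathbf 1_{\{x(j-1)>x(j)\}}+\mathbf 1_{\{x(j+1)>x(j)\}}$. The crystal process $X^k$ is the continuous-time Markov chain on $\mathbb{N}^k$ jumping from $x$ to $x+e_j$ at rate $\beta_{V_j(x)}$, no other transitions; its shape process is $H^k_t=(X^k_t(1)-X^k_t(2),\dots,X^k_t(k-1)-X^k_t(k))\in\mathbb{Z}^{k-1}$, a Markov chain; ergodic means positive recurrent. *)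

theory Defs
  imports "HOL-Analysis.Analysis"
begin

text \<open>A rate function Q gives the jump rate Q i j from state i to state j (i \<noteq> j).
  Positive recurrence of state i (Norris): the expected return time
  E_i[T_i], T_i = inf{t \<ge> J_1 : X_t = i}, is finite. We compute it via the jump
  chain: a return excursion is a list ys of intermediate states not containing i;
  the holding time in state x is exponential with mean 1/q(x).\<close>

definition exit_rate :: "('s \<Rightarrow> 's \<Rightarrow> real) \<Rightarrow> 's \<Rightarrow> ennreal" where
  "exit_rate Q i = (\<integral>\<^sup>+ j. ennreal (Q i j) \<partial>count_space (UNIV - {i}))"

definition jump_prob :: "('s \<Rightarrow> 's \<Rightarrow> real) \<Rightarrow> 's \<Rightarrow> 's \<Rightarrow> ennreal" where
  "jump_prob Q i j = (if i = j then 0 else ennreal (Q i j) / exit_rate Q i)"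

fun path_prob :: "('s \<Rightarrow> 's \<Rightarrow> real) \<Rightarrow> 's list \<Rightarrow> ennreal" where
  "path_prob Q (a # b # rest) = jump_prob Q a b * path_prob Q (b # rest)"
| "path_prob Q _ = 1"

definition path_time :: "('s \<Rightarrow> 's \<Rightarrow> real) \<Rightarrow> 's list \<Rightarrow> ennreal" where
  "path_time Q xs = sum_list (map (\<lambda>x. inverse (exit_rate Q x)) xs)"

definition return_prob :: "('s \<Rightarrow> 's \<Rightarrow> real) \<Rightarrow> 's \<Rightarrow> ennreal" where
  "return_prob Q i =
     (\<integral>\<^sup>+ ys. path_prob Q (i # ys @ [i]) \<partial>count_space {ys. i \<notin> set ys})"

text \<open>Expected return time; the event of never returning contributes \<infinity>.\<close>
definition expected_return_time :: "('s \<Rightarrow> 's \<Rightarrow> real) \<Rightarrow> 's \<Rightarrow> ennreal" where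
  "expected_return_time Q i =
     (\<integral>\<^sup>+ ys. path_prob Q (i # ys @ [i]) * path_time Q (i # ys) \<partial>count_space {ys. i \<notin> set ys})
     + (if return_prob Q i < 1 then top else 0)"

definition positive_recurrent :: "('s \<Rightarrow> 's \<Rightarrow> real) \<Rightarrow> 's \<Rightarrow> bool" where
  "positive_recurrent Q i \<longleftrightarrow> expected_return_time Q i < top"

definition crystal_states :: "nat \<Rightarrow> (nat \<Rightarrow> nat) set" where
  "crystal_states k = {x. \<forall>i. (i = 0 \<or> k < i) \<longrightarrow> x i = 0}"

definition Vnum :: "(nat \<Rightarrow> nat) \<Rightarrow> nat \<Rightarrow> nat" where
  "Vnum x j = (if x (j - 1) > x j then 1 else 0) + (if x (j + 1) > x j then 1 else 0)"

definition beta :: "real \<Rightarrow> real \<Rightarrow> real \<Rightarrow> nat \<Rightarrow> real" where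
  "beta b0 b1 b2 v = (if v = 0 then b0 else if v = 1 then b1 else b2)"

definition crystal_rate :: "real \<Rightarrow> real \<Rightarrow> real \<Rightarrow> (nat \<Rightarrow> nat) \<Rightarrow> nat \<Rightarrow> real" where
  "crystal_rate b0 b1 b2 x j = beta b0 b1 b2 (Vnum x j)"

definition incr :: "(nat \<Rightarrow> nat) \<Rightarrow> nat \<Rightarrow> (nat \<Rightarrow> nat)" where
  "incr x j = x(j := x j + 1)"

definition shape :: "nat \<Rightarrow> (nat \<Rightarrow> nat) \<Rightarrow> (nat \<Rightarrow> int)" where
  "shape k x = (\<lambda>i. if 1 \<le> i \<and> i \<le> k - 1 then int (x i) - int (x (i + 1)) else 0)"

definition shape_states :: "nat \<Rightarrow> (nat \<Rightarrow> int) set" where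
  "shape_states k = {h. \<forall>i. (i = 0 \<or> k \<le> i) \<longrightarrow> h i = 0}"

text \<open>A crystal state with given shape (the shape process is Markov, so the
  rates do not depend on the choice of representative).\<close>
definition shape_rep :: "nat \<Rightarrow> (nat \<Rightarrow> int) \<Rightarrow> (nat \<Rightarrow> nat)" where
  "shape_rep k h = (SOME x. x \<in> crystal_states k \<and> shape k x = h)"

definition shape_rate :: "real \<Rightarrow> real \<Rightarrow> real \<Rightarrow> nat \<Rightarrow> (nat \<Rightarrow> int) \<Rightarrow> (nat \<Rightarrow> int) \<Rightarrow> real" where
  "shape_rate b0 b1 b2 k h h' =
     (\<Sum>j \<in> {j \<in> {1..k}. shape k (incr (shape_rep k h) j) = h'}.
        crystal_rate b0 b1 b2 (shape_rep k h) j)"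

text \<open>Ergodic = positive recurrent (every state of the irreducible chain).\<close>
definition shape_ergodic :: "real \<Rightarrow> real \<Rightarrow> real \<Rightarrow> nat \<Rightarrow> bool" where
  "shape_ergodic b0 b1 b2 k \<longleftrightarrow>
     (\<forall>h \<in> shape_states k. positive_recurrent (shape_rate b0 b1 b2 k) h)"

end

theory Submission
  imports Defs
begin

text \<open>
  By Foster's criterion it suffices to find a shift-invariant function of the heights with negative
  drift once the spread of the heights is large. For \<open>b < k\<close> let \<open>\<Phi>\<^sub>b\<close> be a smoothed maximum of the heights
  on \<open>{b+1..k}\<close>; the Lyapunov function is the sum of \<open>exp (f / K)\<close> over \<open>f = \<Phi>\<^sub>b - x\<^sub>b + a b\<close> and the
  mirror images of these functions. If the spread is large and \<open>f\<close> is close to the largest of these,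
  then the tilt \<open>a b\<close> forces \<open>x\<^sub>b < x\<^bsub>b+1\<^esub>\<close>, so that site \<open>b\<close> grows at rate at least \<open>b2\<close> (exactly \<open>b1\<close> if
  \<open>b = 1\<close>), and it remains to choose \<open>\<Phi>\<^sub>b\<close> growing more slowly than that. Under (a) it is the maximum
  itself, since highest sites grow at rate \<open>b0\<close>; under (b), and for \<open>b = 1\<close>, it is a soft maximum of averages over
  subsets of the block; under (c) it is the logarithm of \<open>exp \<circ> x\<close> summed over the block plus a multiple of its
  total variation.
\<close>

lemma nn_integral_count_space_list:
  fixes g :: "'a list \<Rightarrow> ennreal"
  shows "(\<integral>\<^sup>+ ys. g ys \<partial>count_space UNIV) =
    g [] + (\<integral>\<^sup>+ y. \<integral>\<^sup>+ ys. g (y # ys) \<partial>count_space UNIV \<partial>count_space UNIV)"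
proof -
  let ?c = "\<lambda>(y, ys). y # ys :: 'a list"
  have "(\<integral>\<^sup>+ ys. g ys \<partial>count_space UNIV) =
      (\<integral>\<^sup>+ ys. g ys * indicator {[]} ys + g ys * indicator (range ?c) ys \<partial>count_space UNIV)"
  proof (intro nn_integral_cong)
    fix ys :: "'a list"
    show "g ys = g ys * indicator {[]} ys + g ys * indicator (range ?c) ys"
      by (cases ys) (auto simp: indicator_def)
  qed
  also have "\<dots> = g [] + (\<integral>\<^sup>+ ys. g ys * indicator (range ?c) ys \<partial>count_space UNIV)"
    by (subst nn_integral_add) (auto simp: one_ennreal_def[symmetric])
  also have "(\<integral>\<^sup>+ ys. g ys * indicator (range ?c) ys \<partial>count_space UNIV) =
      (\<integral>\<^sup>+ z. g (?c z) \<partial>count_space UNIV)"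
    using nn_integral_count_compose_inj[of ?c UNIV g] by (auto simp: inj_on_def)
  also have "\<dots> = (\<integral>\<^sup>+ y. \<integral>\<^sup>+ ys. g (y # ys) \<partial>count_space UNIV \<partial>count_space UNIV)"
    using nn_integral_fst_count_space[of "\<lambda>z. g (?c z)"] by simp
  finally show ?thesis .
qed

lemma nn_integral_count_space_list_SUP:
  fixes g :: "'a list \<Rightarrow> ennreal"
  shows "(\<integral>\<^sup>+ ys. g ys \<partial>count_space A) =
    (SUP n. \<integral>\<^sup>+ ys. g ys * indicator {ys \<in> A. length ys < n} ys \<partial>count_space UNIV)"
proof -
  have "(\<integral>\<^sup>+ ys. g ys \<partial>count_space A) = (\<integral>\<^sup>+ ys. g ys * indicator A ys \<partial>count_space UNIV)"
    by (simp add: nn_integral_count_space_indicator)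
  also have "\<dots> = (\<integral>\<^sup>+ ys. (SUP n. g ys * indicator {ys \<in> A. length ys < n} ys) \<partial>count_space UNIV)"
  proof (intro nn_integral_cong antisym)
    fix ys
    show "g ys * indicator A ys \<le> (SUP n. g ys * indicator {ys \<in> A. length ys < n} ys)"
      by (rule SUP_upper2[of "Suc (length ys)"]) (auto simp: indicator_def)
    show "(SUP n. g ys * indicator {ys \<in> A. length ys < n} ys) \<le> g ys * indicator A ys"
      by (rule SUP_least) (auto simp: indicator_def)
  qed
  also have "\<dots> = (SUP n. \<integral>\<^sup>+ ys. g ys * indicator {ys \<in> A. length ys < n} ys \<partial>count_space UNIV)"
    by (intro nn_integral_monotone_convergence_SUP)
       (auto simp: incseq_def le_fun_def indicator_def)
  finally show ?thesis .
qed

locale finite_rate_chain =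
  fixes Q :: "'s \<Rightarrow> 's \<Rightarrow> real" and N :: "'s \<Rightarrow> 's set" and S :: "'s set"
  assumes finite_N: "x \<in> S \<Longrightarrow> finite (N x)"
    and N_closed: "x \<in> S \<Longrightarrow> N x \<subseteq> S"
    and N_irrefl: "x \<in> S \<Longrightarrow> x \<notin> N x"
    and rate_nonneg: "x \<in> S \<Longrightarrow> 0 \<le> Q x y"
    and rate_eq_0: "x \<in> S \<Longrightarrow> y \<notin> N x \<Longrightarrow> Q x y = 0"
    and total_pos: "x \<in> S \<Longrightarrow> 0 < (\<Sum>y\<in>N x. Q x y)"
begin

definition total :: "'s \<Rightarrow> real" where
  "total x = (\<Sum>y\<in>N x. Q x y)"

definition prob :: "'s \<Rightarrow> 's \<Rightarrow> real" where
  "prob x y = Q x y / total x"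

lemma exit_rate_eq: "x \<in> S \<Longrightarrow> exit_rate Q x = ennreal (total x)"
  unfolding exit_rate_def total_def
  using finite_N N_irrefl rate_eq_0 rate_nonneg
  by (subst nn_integral_count_space'[of "N x"]) auto

lemma jump_prob_eq: "x \<in> S \<Longrightarrow> jump_prob Q x y = ennreal (prob x y)"
  using total_pos[of x] N_irrefl[of x] rate_eq_0[of x x] rate_nonneg[of x y]
  by (auto simp: jump_prob_def exit_rate_eq prob_def divide_ennreal total_def)

lemma prob_nonneg: "x \<in> S \<Longrightarrow> 0 \<le> prob x y"
  using total_pos[of x] rate_nonneg[of x y] by (simp add: prob_def total_def)

lemma prob_eq_0: "x \<in> S \<Longrightarrow> y \<notin> N x \<Longrightarrow> prob x y = 0"
  by (simp add: prob_def rate_eq_0)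

lemma sum_prob: "x \<in> S \<Longrightarrow> (\<Sum>y\<in>N x. prob x y) = 1"
  using total_pos[of x] by (simp add: prob_def total_def flip: sum_divide_distrib)

lemma prob_split: "x \<in> S \<Longrightarrow> prob x i + (\<Sum>y\<in>N x - {i}. prob x y) = 1"
  using sum_prob[of x] finite_N[of x] prob_eq_0[of x i]
  by (cases "i \<in> N x") (auto simp: sum.remove)

lemma hold_pos: "x \<in> S \<Longrightarrow> 0 < 1 / total x"
  using total_pos[of x] by (simp add: total_def)

lemma hold_eq: "x \<in> S \<Longrightarrow> inverse (exit_rate Q x) = ennreal (1 / total x)"
  using total_pos[of x] by (simp add: exit_rate_eq inverse_ennreal total_def inverse_eq_divide)

context
  fixes i :: 's
begin

primrec surv :: "nat \<Rightarrow> 's \<Rightarrow> real" where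
  "surv 0 x = 1"
| "surv (Suc n) x = (\<Sum>y\<in>N x - {i}. prob x y * surv n y)"

text \<open>\<open>trunc_time n x\<close> is the mean of the first hitting time of \<open>i\<close> after time 0, stopped at the
  \<open>n\<close>-th jump.\<close>

primrec trunc_time :: "nat \<Rightarrow> 's \<Rightarrow> real" where
  "trunc_time 0 x = 0"
| "trunc_time (Suc n) x = 1 / total x + (\<Sum>y\<in>N x - {i}. prob x y * trunc_time n y)"

abbreviation ret_paths :: "nat \<Rightarrow> 's list set" where
  "ret_paths n \<equiv> {ys \<in> {ys. i \<notin> set ys}. length ys < n}"

lemma surv_bounds: "x \<in> S \<Longrightarrow> 0 \<le> surv n x \<and> surv n x \<le> 1"
proof (induction n arbitrary: x)
  case (Suc n)
  have "surv (Suc n) x \<le> (\<Sum>y\<in>N x - {i}. prob x y * 1)"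
    unfolding surv.simps using Suc N_closed
    by (intro sum_mono mult_left_mono) (auto simp: prob_nonneg)
  also have "\<dots> \<le> 1" using prob_split[of x i] prob_nonneg[of x i] Suc.prems by simp
  finally show ?case using Suc N_closed
    by (auto intro!: sum_nonneg mult_nonneg_nonneg prob_nonneg)
qed simp

lemma trunc_time_nonneg: "x \<in> S \<Longrightarrow> 0 \<le> trunc_time n x"
proof (induction n arbitrary: x)
  case (Suc n)
  then show ?case using N_closed hold_pos[of x]
    by (auto intro!: add_nonneg_nonneg sum_nonneg mult_nonneg_nonneg prob_nonneg)
qed simp

lemma trunc_time_mono: "x \<in> S \<Longrightarrow> trunc_time n x \<le> trunc_time (Suc n) x"
proof (induction n arbitrary: x)
  case 0
  then show ?case using trunc_time_nonneg[of x 1] by simp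
next
  case (Suc n)
  then show ?case unfolding trunc_time.simps(2)[of n] trunc_time.simps(2)[of "Suc n"]
    using N_closed[of x] by (intro add_mono sum_mono mult_left_mono) (auto simp: prob_nonneg)
qed

lemma nn_integral_jump:
  assumes "x \<in> S" and "\<And>y. y = i \<Longrightarrow> f y = 0"
  shows "(\<integral>\<^sup>+ y. jump_prob Q x y * f y \<partial>count_space UNIV) =
    (\<Sum>y\<in>N x - {i}. ennreal (prob x y) * f y)"
  using assms finite_N[of x] prob_eq_0[of x]
  by (subst nn_integral_count_space'[of "N x - {i}"]) (auto simp: jump_prob_eq)

lemma return_prob_trunc:
  "x \<in> S \<Longrightarrow> (\<integral>\<^sup>+ ys. path_prob Q (x # ys @ [i]) * indicator (ret_paths n) ys \<partial>count_space UNIV) =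
     ennreal (1 - surv n x)"
proof (induction n arbitrary: x)
  case (Suc n)
  let ?R = "\<lambda>y. \<integral>\<^sup>+ ys. path_prob Q (y # ys @ [i]) * indicator (ret_paths n) ys \<partial>count_space UNIV"
  have "(\<integral>\<^sup>+ ys. path_prob Q (x # ys @ [i]) * indicator (ret_paths (Suc n)) ys \<partial>count_space UNIV) =
     jump_prob Q x i + (\<integral>\<^sup>+ y. \<integral>\<^sup>+ ys. jump_prob Q x y * path_prob Q (y # ys @ [i]) *
       indicator (ret_paths (Suc n)) (y # ys) \<partial>count_space UNIV \<partial>count_space UNIV)"
    by (subst nn_integral_count_space_list) simp
  also have "(\<integral>\<^sup>+ y. \<integral>\<^sup>+ ys. jump_prob Q x y * path_prob Q (y # ys @ [i]) *
       indicator (ret_paths (Suc n)) (y # ys) \<partial>count_space UNIV \<partial>count_space UNIV) =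
     (\<integral>\<^sup>+ y. jump_prob Q x y * (if y = i then 0 else ?R y) \<partial>count_space UNIV)"
  proof (intro nn_integral_cong)
    fix y
    have "(\<integral>\<^sup>+ ys. jump_prob Q x y * path_prob Q (y # ys @ [i]) *
       indicator (ret_paths (Suc n)) (y # ys) \<partial>count_space UNIV) =
      (\<integral>\<^sup>+ ys. jump_prob Q x y * (if y = i then 0 else path_prob Q (y # ys @ [i]) *
       indicator (ret_paths n) ys) \<partial>count_space UNIV)"
      by (intro nn_integral_cong) (auto simp: indicator_def)
    then show "(\<integral>\<^sup>+ ys. jump_prob Q x y * path_prob Q (y # ys @ [i]) *
       indicator (ret_paths (Suc n)) (y # ys) \<partial>count_space UNIV) =
       jump_prob Q x y * (if y = i then 0 else ?R y)"
      by (auto simp: nn_integral_cmult)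
  qed
  also have "\<dots> = (\<Sum>y\<in>N x - {i}. ennreal (prob x y) * (if y = i then 0 else ?R y))"
    using Suc.prems by (intro nn_integral_jump) auto
  also have "\<dots> = (\<Sum>y\<in>N x - {i}. ennreal (prob x y * (1 - surv n y)))"
    using Suc N_closed[of x] by (intro sum.cong) (auto simp: ennreal_mult' prob_nonneg)
  also have "\<dots> = ennreal (\<Sum>y\<in>N x - {i}. prob x y * (1 - surv n y))"
    using Suc.prems N_closed[of x] surv_bounds
    by (intro sum_ennreal) (auto intro!: mult_nonneg_nonneg prob_nonneg simp: subset_iff)
  also have "jump_prob Q x i + \<dots> = ennreal (prob x i + (\<Sum>y\<in>N x - {i}. prob x y * (1 - surv n y)))"
    using Suc.prems N_closed[of x] surv_bounds
    by (subst ennreal_plus)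
      (auto intro!: sum_nonneg mult_nonneg_nonneg prob_nonneg simp: subset_iff jump_prob_eq)
  also have "prob x i + (\<Sum>y\<in>N x - {i}. prob x y * (1 - surv n y)) = 1 - surv (Suc n) x"
    using prob_split[OF Suc.prems, of i] by (simp add: algebra_simps sum_subtractf)
  finally show ?case .
qed simp

lemma return_time_trunc:
  "x \<in> S \<Longrightarrow> (\<integral>\<^sup>+ ys. path_prob Q (x # ys @ [i]) * path_time Q (x # ys) * indicator (ret_paths n) ys
     \<partial>count_space UNIV) \<le> ennreal (trunc_time n x)"
proof (induction n arbitrary: x)
  case (Suc n)
  let ?h = "ennreal (1 / total x)"
  let ?R = "\<lambda>y. \<integral>\<^sup>+ ys. path_prob Q (y # ys @ [i]) * indicator (ret_paths n) ys \<partial>count_space UNIV"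
  let ?E = "\<lambda>y. \<integral>\<^sup>+ ys. path_prob Q (y # ys @ [i]) * path_time Q (y # ys) * indicator (ret_paths n) ys
    \<partial>count_space UNIV"
  have nn: "0 \<le> prob x y * (1 / total x + trunc_time n y)" if "y \<in> N x - {i}" for y
    using that N_closed[OF Suc.prems] hold_pos[OF Suc.prems] trunc_time_nonneg[of y n]
    by (intro mult_nonneg_nonneg add_nonneg_nonneg prob_nonneg[OF Suc.prems]) auto
  have h: "path_time Q (x # ys) = ?h + path_time Q ys" for ys
    using Suc.prems by (simp add: path_time_def hold_eq)
  have "(\<integral>\<^sup>+ ys. path_prob Q (x # ys @ [i]) * path_time Q (x # ys) * indicator (ret_paths (Suc n)) ys
       \<partial>count_space UNIV) =
     jump_prob Q x i * ?h + (\<integral>\<^sup>+ y. \<integral>\<^sup>+ ys. jump_prob Q x y * path_prob Q (y # ys @ [i]) *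
       (?h + path_time Q (y # ys)) *
       indicator (ret_paths (Suc n)) (y # ys) \<partial>count_space UNIV \<partial>count_space UNIV)"
    unfolding h by (subst nn_integral_count_space_list) (simp add: path_time_def)
  also have "(\<integral>\<^sup>+ y. \<integral>\<^sup>+ ys. jump_prob Q x y * path_prob Q (y # ys @ [i]) *
       (?h + path_time Q (y # ys)) *
       indicator (ret_paths (Suc n)) (y # ys) \<partial>count_space UNIV \<partial>count_space UNIV) =
     (\<integral>\<^sup>+ y. jump_prob Q x y * (if y = i then 0 else ?h * ?R y + ?E y) \<partial>count_space UNIV)"
  proof (intro nn_integral_cong)
    fix y
    have "(\<integral>\<^sup>+ ys. jump_prob Q x y * path_prob Q (y # ys @ [i]) * (?h + path_time Q (y # ys)) *
       indicator (ret_paths (Suc n)) (y # ys) \<partial>count_space UNIV) =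
      (\<integral>\<^sup>+ ys. jump_prob Q x y * (if y = i then 0 else
        ?h * (path_prob Q (y # ys @ [i]) * indicator (ret_paths n) ys) +
        path_prob Q (y # ys @ [i]) * path_time Q (y # ys) * indicator (ret_paths n) ys) \<partial>count_space UNIV)"
      by (intro nn_integral_cong) (auto simp: indicator_def algebra_simps)
    then show "(\<integral>\<^sup>+ ys. jump_prob Q x y * path_prob Q (y # ys @ [i]) * (?h + path_time Q (y # ys)) *
       indicator (ret_paths (Suc n)) (y # ys) \<partial>count_space UNIV) =
       jump_prob Q x y * (if y = i then 0 else ?h * ?R y + ?E y)"
      by (auto simp: nn_integral_cmult nn_integral_add)
  qed
  also have "\<dots> = (\<Sum>y\<in>N x - {i}. ennreal (prob x y) * (if y = i then 0 else ?h * ?R y + ?E y))"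
    using Suc.prems by (intro nn_integral_jump) auto
  finally have *: "(\<integral>\<^sup>+ ys. path_prob Q (x # ys @ [i]) * path_time Q (x # ys) *
      indicator (ret_paths (Suc n)) ys \<partial>count_space UNIV) = jump_prob Q x i * ?h +
      (\<Sum>y\<in>N x - {i}. ennreal (prob x y) * (if y = i then 0 else ?h * ?R y + ?E y))" .
  have "(\<Sum>y\<in>N x - {i}. ennreal (prob x y) * (if y = i then 0 else ?h * ?R y + ?E y)) \<le>
      (\<Sum>y\<in>N x - {i}. ennreal (prob x y * (1 / total x + trunc_time n y)))"
  proof (intro sum_mono)
    fix y assume y: "y \<in> N x - {i}"
    then have yS: "y \<in> S" using N_closed Suc.prems by auto
    have "?R y \<le> 1"
      using surv_bounds[OF yS, of n] by (subst return_prob_trunc[OF yS]) simp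
    then have "?h * ?R y + ?E y \<le> ?h * 1 + ennreal (trunc_time n y)"
      by (intro add_mono mult_left_mono Suc.IH yS) auto
    also have "\<dots> = ennreal (1 / total x + trunc_time n y)"
      using hold_pos[OF Suc.prems] trunc_time_nonneg[OF yS, of n] by (simp add: ennreal_plus)
    finally show "ennreal (prob x y) * (if y = i then 0 else ?h * ?R y + ?E y) \<le>
        ennreal (prob x y * (1 / total x + trunc_time n y))"
      using y Suc.prems by (auto simp: ennreal_mult' prob_nonneg intro!: mult_left_mono)
  qed
  also have "\<dots> = ennreal (\<Sum>y\<in>N x - {i}. prob x y * (1 / total x + trunc_time n y))"
    by (rule sum_ennreal) (rule nn)
  finally have "jump_prob Q x i * ?h +
      (\<Sum>y\<in>N x - {i}. ennreal (prob x y) * (if y = i then 0 else ?h * ?R y + ?E y)) \<le>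
      jump_prob Q x i * ?h + ennreal (\<Sum>y\<in>N x - {i}. prob x y * (1 / total x + trunc_time n y))"
    by (rule add_left_mono)
  also have "\<dots> = ennreal (prob x i * (1 / total x) + (\<Sum>y\<in>N x - {i}. prob x y * (1 / total x + trunc_time n y)))"
    using Suc.prems nn hold_pos[OF Suc.prems] prob_nonneg[OF Suc.prems, of i]
    by (subst ennreal_plus) (auto intro!: sum_nonneg simp: jump_prob_eq simp flip: ennreal_mult')
  also have "prob x i * (1 / total x) + (\<Sum>y\<in>N x - {i}. prob x y * (1 / total x + trunc_time n y)) =
      (prob x i + (\<Sum>y\<in>N x - {i}. prob x y)) * (1 / total x) +
      (\<Sum>y\<in>N x - {i}. prob x y * trunc_time n y)"
    by (simp add: distrib_left distrib_right sum.distrib add_divide_distrib sum_divide_distrib)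
  also have "\<dots> = trunc_time (Suc n) x"
    using prob_split[OF Suc.prems, of i] by simp
  finally show ?case unfolding * .
qed simp

lemma sum_surv_le_trunc_time:
  assumes "\<And>x. x \<in> S \<Longrightarrow> total x \<le> hi"
  shows "x \<in> S \<Longrightarrow> (\<Sum>r<n. surv r x) / hi \<le> trunc_time n x"
proof (induction n arbitrary: x)
  case (Suc n)
  have "1 / hi \<le> 1 / total x"
    using assms[OF Suc.prems] total_pos[OF Suc.prems] by (simp add: total_def frac_le)
  moreover have "(\<Sum>r<n. surv (Suc r) x) / hi = (\<Sum>y\<in>N x - {i}. prob x y * ((\<Sum>r<n. surv r y) / hi))"
    by (simp add: sum_divide_distrib sum_distrib_left) (rule sum.swap)
  moreover have "\<dots> \<le> (\<Sum>y\<in>N x - {i}. prob x y * trunc_time n y)"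
    using Suc N_closed[of x] by (intro sum_mono mult_left_mono) (auto simp: prob_nonneg)
  ultimately show ?case
    by (simp add: sum.lessThan_Suc_shift add_divide_distrib del: sum.lessThan_Suc surv.simps(2))
qed simp

lemma positive_recurrent_if_trunc_time_bounded:
  assumes "i \<in> S" and hi: "\<And>x. x \<in> S \<Longrightarrow> total x \<le> hi" and B: "\<And>n. trunc_time n i \<le> B"
  shows "positive_recurrent Q i"
proof -
  have hi0: "0 < hi" using hi[OF \<open>i \<in> S\<close>] total_pos[OF \<open>i \<in> S\<close>] by (simp add: total_def)
  have "(\<Sum>r<n. surv r i) \<le> B * hi" for n
    using order_trans[OF sum_surv_le_trunc_time[OF hi \<open>i \<in> S\<close>, of n] B[of n]] hi0
    by (simp add: divide_le_eq)
  then have "summable (\<lambda>r. surv r i)"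
    using surv_bounds[OF \<open>i \<in> S\<close>] by (intro summableI_nonneg_bounded) auto
  then have "(\<lambda>n. surv n i) \<longlonglongrightarrow> 0" by (rule summable_LIMSEQ_zero)
  then have lim: "(\<lambda>n. ennreal (1 - surv n i)) \<longlonglongrightarrow> ennreal (1 - 0)"
    by (intro tendsto_intros)
  have "ennreal (1 - surv n i) \<le> return_prob Q i" for n
    unfolding return_prob_def
    by (subst nn_integral_count_space_list_SUP, subst return_prob_trunc[OF \<open>i \<in> S\<close>])
      (rule SUP_upper, simp)
  then have "ennreal (1 - 0) \<le> return_prob Q i" by (intro LIMSEQ_le_const2[OF lim]) simp
  moreover have "(\<integral>\<^sup>+ ys. path_prob Q (i # ys @ [i]) * path_time Q (i # ys) \<partial>count_space {ys. i \<notin> set ys})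
      \<le> ennreal B"
    by (subst nn_integral_count_space_list_SUP)
      (intro SUP_least order_trans[OF return_time_trunc[OF \<open>i \<in> S\<close>]] ennreal_leI B)
  ultimately show ?thesis
    unfolding positive_recurrent_def expected_return_time_def
    using ennreal_less_top[of B] by (auto simp: not_less intro: order.strict_trans1)
qed

end

lemma foster_positive_recurrent:
  fixes V :: "'s \<Rightarrow> real"
  assumes "i \<in> S" and hi: "\<And>x. x \<in> S \<Longrightarrow> total x \<le> hi"
    and V_nonneg: "\<And>x. x \<in> S \<Longrightarrow> 0 \<le> V x"
    and "finite C"
    and drift: "\<And>x. x \<in> S \<Longrightarrow> x \<notin> C \<Longrightarrow> (\<Sum>y\<in>N x. Q x y * (V y - V x)) \<le> -1"
    and reach: "\<And>x. x \<in> S \<Longrightarrow> (x, i) \<in> {(x, y). x \<in> S \<and> 0 < Q x y}\<^sup>+"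
  shows "positive_recurrent Q i"
proof -
  let ?t = "trunc_time i"
  define C' where "C' = insert i (C \<inter> S)"
  have C': "finite C'" "C' \<noteq> {}" "C' \<subseteq> S" using assms by (auto simp: C'_def)
  define m where "m n = Max (?t n ` C')" for n
  have m_ge: "?t n x \<le> m n" if "x \<in> C'" for n x
    using that C' by (auto simp: m_def)
  have m_nonneg: "0 \<le> m n" for n
    using m_ge[of i n] trunc_time_nonneg[OF \<open>i \<in> S\<close>, of i n] by (auto simp: C'_def)
  have m_mono: "m n \<le> m (Suc n)" for n
    unfolding m_def[of n] using C' m_ge[of _ "Suc n"] trunc_time_mono[of _ i n]
    by (subst Max_le_iff) (auto intro: order_trans)
  have V_drift: "1 / total x + (\<Sum>y\<in>N x. prob x y * V y) \<le> V x" if "x \<in> S" "x \<notin> C" for x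
  proof -
    have "(\<Sum>y\<in>N x. prob x y * (V y - V x)) \<le> -1 / total x"
      using divide_right_mono[OF drift[OF that], of "total x"] total_pos[OF that(1)]
      by (simp add: prob_def total_def flip: sum_divide_distrib)
    moreover have "(\<Sum>y\<in>N x. prob x y * (V y - V x)) = (\<Sum>y\<in>N x. prob x y * V y) - V x"
      using sum_prob[OF that(1)] by (simp add: right_diff_distrib sum_subtractf flip: sum_distrib_right)
    ultimately show ?thesis by simp
  qed
  have t_le: "?t n x \<le> V x + m n" if "x \<in> S" for n x
    using that
  proof (induction n arbitrary: x)
    case 0
    then show ?case using V_nonneg m_nonneg by (simp add: add_nonneg_nonneg)
  next
    case (Suc n)
    show ?case
    proof (cases "x \<in> C'")
      case True
      then show ?thesis using m_ge[OF True, of "Suc n"] V_nonneg[OF Suc.prems] by linarith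
    next
      case False
      have "?t (Suc n) x \<le> 1 / total x + (\<Sum>y\<in>N x - {i}. prob x y * (V y + m n))"
        unfolding trunc_time.simps using Suc N_closed[of x]
        by (intro add_left_mono sum_mono mult_left_mono) (auto simp: prob_nonneg)
      also have "\<dots> \<le> 1 / total x + (\<Sum>y\<in>N x. prob x y * (V y + m n))"
        using Suc.prems N_closed[of x] finite_N[of x] V_nonneg m_nonneg
        by (intro add_left_mono sum_mono2 mult_nonneg_nonneg prob_nonneg add_nonneg_nonneg) auto
      also have "\<dots> = 1 / total x + (\<Sum>y\<in>N x. prob x y * V y) + m n"
        using sum_prob[OF Suc.prems] by (simp add: distrib_left sum.distrib flip: sum_distrib_right)
      also have "\<dots> \<le> V x + m (Suc n)"
        using V_drift[OF Suc.prems] False Suc.prems m_mono[of n] by (force simp: C'_def)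
      finally show ?thesis .
    qed
  qed
  have edge: "\<exists>B \<alpha>. \<alpha> < 1 \<and> (\<forall>n. ?t n x \<le> B + \<alpha> * m n)"
    if x: "x \<in> S" "0 < Q x z" and z: "z = i \<or> (\<exists>B \<alpha>. \<alpha> < 1 \<and> (\<forall>n. ?t n z \<le> B + \<alpha> * m n))" for x z
  proof -
    obtain B \<alpha> where B: "\<alpha> < 1" "\<And>n. z \<noteq> i \<Longrightarrow> ?t n z \<le> B + \<alpha> * m n" "z = i \<Longrightarrow> B = 0 \<and> \<alpha> = 0"
      using z by (metis zero_less_one)
    have zN: "z \<in> N x" using x rate_eq_0[of x z] by force
    have p: "0 < prob x z" using x hold_pos[of x] by (simp add: prob_def)
    define B' where "B' = 1 / total x + (\<Sum>y\<in>N x. prob x y * V y) + prob x z * B"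
    define \<alpha>' where "\<alpha>' = 1 - prob x z + prob x z * \<alpha>"
    have "\<alpha>' < 1" using p B(1) by (simp add: \<alpha>'_def)
    moreover have "?t n x \<le> B' + \<alpha>' * m n" for n
    proof -
      have yS: "y \<in> S" if "y \<in> N x" for y using that N_closed x by auto
      have "?t n x \<le> ?t (Suc n) x" by (rule trunc_time_mono) fact
      also have "\<dots> \<le> 1 / total x + ((\<Sum>y\<in>N x - {z}. prob x y * (V y + m n)) + prob x z * (B + \<alpha> * m n))"
      proof -
        have "(\<Sum>y\<in>N x - {i}. prob x y * ?t n y) = (\<Sum>y\<in>N x. if y = i then 0 else prob x y * ?t n y)"
          using finite_N[OF x(1)] by (intro sum.mono_neutral_cong_left) auto
        also have "\<dots> = (\<Sum>y\<in>N x - {z}. if y = i then 0 else prob x y * ?t n y) +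
            (if z = i then 0 else prob x z * ?t n z)"
          using finite_N[OF x(1)] zN by (simp add: sum.remove[of _ z])
        also have "\<dots> \<le> (\<Sum>y\<in>N x - {z}. prob x y * (V y + m n)) + prob x z * (B + \<alpha> * m n)"
          using x(1) yS t_le V_nonneg m_nonneg[of n] B p
          by (intro add_mono sum_mono)
            (auto intro!: mult_left_mono mult_nonneg_nonneg add_nonneg_nonneg prob_nonneg)
        finally show ?thesis by simp
      qed
      also have "(\<Sum>y\<in>N x - {z}. prob x y * (V y + m n)) =
          (\<Sum>y\<in>N x. prob x y * (V y + m n)) - prob x z * (V z + m n)"
        using finite_N[OF x(1)] zN by (simp add: sum.remove[of _ z])
      also have "(\<Sum>y\<in>N x. prob x y * (V y + m n)) = (\<Sum>y\<in>N x. prob x y * V y) + m n"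
        using sum_prob[OF x(1)] by (simp add: distrib_left sum.distrib flip: sum_distrib_right)
      also have "1 / total x + ((\<Sum>y\<in>N x. prob x y * V y) + m n - prob x z * (V z + m n) +
          prob x z * (B + \<alpha> * m n)) = B' + \<alpha>' * m n - prob x z * V z"
        by (simp add: B'_def \<alpha>'_def algebra_simps)
      also have "\<dots> \<le> B' + \<alpha>' * m n" using p V_nonneg[OF yS[OF zN]] by simp
      finally show ?thesis .
    qed
    ultimately show ?thesis by blast
  qed
  have good: "\<exists>B \<alpha>. \<alpha> < 1 \<and> (\<forall>n. ?t n x \<le> B + \<alpha> * m n)" if "x \<in> S" for x
    using reach[OF that]
  proof (induction rule: converse_trancl_induct)
    case (base y)
    then show ?case using edge[of y i] by auto
  next
    case (step y z)
    then show ?case using edge[of y z] by auto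
  qed
  then obtain B \<alpha> where B: "\<And>x. x \<in> S \<Longrightarrow> \<alpha> x < 1" "\<And>x n. x \<in> S \<Longrightarrow> ?t n x \<le> B x + \<alpha> x * m n"
    by metis
  have "m n \<le> Max ((\<lambda>x. B x / (1 - \<alpha> x)) ` C')" for n
  proof -
    have "m n \<in> ?t n ` C'" unfolding m_def using C' by (intro Max_in) auto
    then obtain x where x: "x \<in> C'" "m n = ?t n x" by auto
    then have "x \<in> S" using C' by auto
    then have "m n \<le> B x / (1 - \<alpha> x)"
      using B(1)[of x] B(2)[of x n] x(2) by (simp add: le_divide_eq algebra_simps)
    then show ?thesis using x(1) C' by (auto intro: Max_ge_iff[THEN iffD2])
  qed
  then show ?thesis
    using m_ge[of i] by (intro positive_recurrent_if_trunc_time_bounded[OF \<open>i \<in> S\<close> hi])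
      (auto simp: C'_def intro: order_trans)
qed

end

lemma crystal_states_outside:
  assumes "x \<in> crystal_states k" and "i \<notin> {1..k}"
  shows "x i = 0"
proof -
  have "i = 0 \<or> k < i" using assms(2) by auto
  moreover have "i = 0 \<or> k < i \<longrightarrow> x i = 0"
    using assms(1) unfolding crystal_states_def mem_Collect_eq by (rule spec)
  ultimately show ?thesis by simp
qed

lemma crystal_states_incr: "x \<in> crystal_states k \<Longrightarrow> j \<in> {1..k} \<Longrightarrow> incr x j \<in> crystal_states k"
  by (auto simp: crystal_states_def incr_def)

lemma shape_in_shape_states: "shape k x \<in> shape_states k"
  by (auto simp: shape_def shape_states_def)

lemma shape_surj:
  assumes "h \<in> shape_states k"
  shows "\<exists>x \<in> crystal_states k. shape k x = h"
proof -
  define M where "M = (\<Sum>l\<in>{1..<k}. \<bar>h l\<bar>)"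
  define x where "x i = (if i \<in> {1..k} then nat (M + (\<Sum>l\<in>{i..<k}. h l)) else 0)" for i
  have nn: "0 \<le> M + (\<Sum>l\<in>{i..<k}. h l)" if "1 \<le> i" for i
  proof -
    have "\<bar>\<Sum>l\<in>{i..<k}. h l\<bar> \<le> (\<Sum>l\<in>{i..<k}. \<bar>h l\<bar>)" by (rule sum_abs)
    also have "\<dots> \<le> M" unfolding M_def using that by (intro sum_mono2) auto
    finally show ?thesis by linarith
  qed
  have "shape k x = h"
  proof
    fix i
    show "shape k x i = h i"
    proof (cases "1 \<le> i \<and> i \<le> k - 1")
      case True
      then have "(\<Sum>l\<in>{i..<k}. h l) = h i + (\<Sum>l\<in>{Suc i..<k}. h l)"
        by (intro sum.atLeast_Suc_lessThan) auto
      then show ?thesis using True nn[of i] nn[of "Suc i"] by (auto simp: shape_def x_def)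
    next
      case False
      then have "i = 0 \<or> k \<le> i" by linarith
      then show ?thesis using assms by (auto simp: shape_def shape_states_def)
    qed
  qed
  moreover have "x \<in> crystal_states k" by (auto simp: x_def crystal_states_def)
  ultimately show ?thesis by blast
qed

lemma shape_rep:
  assumes "h \<in> shape_states k"
  shows "shape_rep k h \<in> crystal_states k" and "shape k (shape_rep k h) = h"
  unfolding shape_rep_def
  using someI_ex[of "\<lambda>x. x \<in> crystal_states k \<and> shape k x = h"] shape_surj[OF assms] by auto

lemma shape_eq_iff_shift:
  "shape k x = shape k y \<longleftrightarrow> (\<exists>t. \<forall>i\<in>{1..k}. int (y i) = int (x i) + t)"
proof
  assume *: "shape k x = shape k y"
  define t where "t = int (y 1) - int (x 1)"
  have "int (y i) = int (x i) + t" if "1 \<le> i" "i \<le> k" for i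
    using that
  proof (induction i rule: dec_induct)
    case (step i)
    then have "i \<le> k - 1" by linarith
    then show ?case using step fun_cong[OF *, of i] by (simp add: shape_def)
  qed (simp add: t_def)
  then show "\<exists>t. \<forall>i\<in>{1..k}. int (y i) = int (x i) + t"
    by (intro exI[of _ t] ballI) simp
next
  assume "\<exists>t. \<forall>i\<in>{1..k}. int (y i) = int (x i) + t"
  then obtain t where t: "\<And>i. 1 \<le> i \<Longrightarrow> i \<le> k \<Longrightarrow> int (y i) = int (x i) + t" by auto
  show "shape k x = shape k y"
  proof
    fix i
    have "i + 1 \<le> k" if "1 \<le> i" "i \<le> k - 1" using that by linarith
    then show "shape k x i = shape k y i" using t[of i] t[of "i + 1"] by (auto simp: shape_def)
  qed
qed

lemma shape_incr_cong: "shape k x = shape k y \<Longrightarrow> shape k (incr x j) = shape k (incr y j)"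
  unfolding shape_eq_iff_shift by (auto simp: incr_def)

lemma shape_incr_neq:
  assumes "2 \<le> k" and "j \<in> {1..k}"
  shows "shape k (incr x j) \<noteq> shape k x"
proof
  assume "shape k (incr x j) = shape k x"
  then obtain t where t: "\<And>i. i \<in> {1..k} \<Longrightarrow> int (x i) = int (incr x j i) + t"
    unfolding shape_eq_iff_shift by auto
  obtain i where "i \<in> {1..k}" "i \<noteq> j"
    using assms(1) that[of 1] that[of 2] by (cases "j = 1") auto
  then show False using t[of i] t[OF assms(2)] by (simp add: incr_def)
qed

lemma Vnum_shape_cong:
  assumes "x \<in> crystal_states k" "y \<in> crystal_states k" "shape k x = shape k y" "j \<in> {1..k}"
  shows "Vnum x j = Vnum y j"
proof -
  obtain t where t: "\<And>i. 1 \<le> i \<Longrightarrow> i \<le> k \<Longrightarrow> int (y i) = int (x i) + t"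
    using assms(3) unfolding shape_eq_iff_shift by auto
  have l: "x (j - 1) > x j \<longleftrightarrow> y (j - 1) > y j"
  proof (cases "j = 1")
    case True
    then show ?thesis using assms by (auto simp: crystal_states_def)
  next
    case False
    then have "1 \<le> j - 1" "j - 1 \<le> k" using assms(4) by auto
    then show ?thesis using t[of j] t[of "j - 1"] assms(4) by auto
  qed
  have r: "x (j + 1) > x j \<longleftrightarrow> y (j + 1) > y j"
  proof (cases "j = k")
    case True
    then show ?thesis using assms by (auto simp: crystal_states_def)
  next
    case False
    then show ?thesis using t[of j] t[of "j + 1"] assms(4) by auto
  qed
  show ?thesis unfolding Vnum_def using l r by simp
qed

lemma crystal_rate_pos: "0 < b0 \<Longrightarrow> 0 < b1 \<Longrightarrow> 0 < b2 \<Longrightarrow> 0 < crystal_rate b0 b1 b2 x j"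
  by (simp add: crystal_rate_def beta_def)

lemma crystal_rate_le: "b0 \<le> b1 \<Longrightarrow> b2 \<le> b1 \<Longrightarrow> crystal_rate b0 b1 b2 x j \<le> b1"
  by (simp add: crystal_rate_def beta_def)

lemma shape_ergodicI:
  fixes V :: "(nat \<Rightarrow> nat) \<Rightarrow> real" and M :: nat
  assumes k: "2 \<le> k" and b: "0 < b0" "0 < b1" "0 < b2" "b0 \<le> b1" "b2 \<le> b1"
    and V_nonneg: "\<And>x. x \<in> crystal_states k \<Longrightarrow> 0 \<le> V x"
    and V_shape: "\<And>x y. x \<in> crystal_states k \<Longrightarrow> y \<in> crystal_states k \<Longrightarrow>
      shape k x = shape k y \<Longrightarrow> V x = V y"
    and drift: "\<And>x p q. x \<in> crystal_states k \<Longrightarrow> p \<in> {1..k} \<Longrightarrow> q \<in> {1..k} \<Longrightarrow> x p + M \<le> x q \<Longrightarrow>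
      (\<Sum>j\<in>{1..k}. crystal_rate b0 b1 b2 x j * (V (incr x j) - V x)) \<le> -1"
  shows "shape_ergodic b0 b1 b2 k"
proof -
  let ?Q = "shape_rate b0 b1 b2 k" and ?S = "shape_states k" and ?r = "crystal_rate b0 b1 b2"
  define N where "N h = (\<lambda>j. shape k (incr (shape_rep k h) j)) ` {1..k}" for h
  have r_pos: "0 < ?r x j" for x j using b by (intro crystal_rate_pos)
  have sum_N: "(\<Sum>y\<in>N h. ?Q h y * g y) =
      (\<Sum>j\<in>{1..k}. ?r (shape_rep k h) j * g (shape k (incr (shape_rep k h) j)))" for h and g :: "_ \<Rightarrow> real"
    unfolding N_def
    by (subst sum.image_gen[of "{1..k}" _ "\<lambda>j. shape k (incr (shape_rep k h) j)"])
      (auto simp: shape_rate_def sum_distrib_right intro!: sum.cong)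
  interpret finite_rate_chain ?Q N ?S
  proof
    fix h h' assume h: "h \<in> ?S"
    show "finite (N h)" by (simp add: N_def)
    show "N h \<subseteq> ?S" by (auto simp: N_def shape_in_shape_states)
    have "shape k (incr (shape_rep k h) j) \<noteq> h" if "j \<in> {1..k}" for j
      using shape_incr_neq[OF k that, of "shape_rep k h"] shape_rep(2)[OF h] by simp
    then show "h \<notin> N h" by (force simp: N_def)
    show "0 \<le> ?Q h h'" unfolding shape_rate_def using r_pos by (intro sum_nonneg less_imp_le) auto
    show "?Q h h' = 0" if "h' \<notin> N h"
    proof -
      have "{j \<in> {1..k}. shape k (incr (shape_rep k h) j) = h'} = {}" using that by (auto simp: N_def)
      then show ?thesis by (simp only: shape_rate_def sum.empty)
    qed
    show "0 < (\<Sum>y\<in>N h. ?Q h y)"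
      using sum_N[of h "\<lambda>_. 1"] r_pos k by (simp add: sum_pos)
  qed
  have edge: "0 < ?Q (shape k x) (shape k (incr x j))" if "x \<in> crystal_states k" "j \<in> {1..k}" for x j
  proof -
    have "shape k (incr (shape_rep k (shape k x)) j) = shape k (incr x j)"
      by (rule shape_incr_cong) (simp add: shape_rep shape_in_shape_states)
    then show ?thesis unfolding shape_rate_def using r_pos that(2) by (intro sum_pos) auto
  qed
  let ?E = "{(x, y). x \<in> ?S \<and> 0 < ?Q x y}"
  have path: "(shape k x, shape k y) \<in> ?E\<^sup>+"
    if "x \<in> crystal_states k" "y \<in> crystal_states k" "\<And>i. x i \<le> y i" "x \<noteq> y" for x y
    using that
  proof (induction "\<Sum>i\<in>{1..k}. y i - x i" arbitrary: x rule: less_induct)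
    case less
    obtain j where "x j \<noteq> y j" using less.prems(4) by auto
    then have j: "x j < y j" using less.prems(3)[of j] by linarith
    then have jk: "j \<in> {1..k}" using crystal_states_outside[OF less.prems(2), of j] by fastforce
    have e: "(shape k x, shape k (incr x j)) \<in> ?E"
      using edge[OF less.prems(1) jk] by (simp add: shape_in_shape_states)
    show ?case
    proof (cases "incr x j = y")
      case True
      then show ?thesis using e by auto
    next
      case False
      have "(\<Sum>i\<in>{1..k}. y i - incr x j i) < (\<Sum>i\<in>{1..k}. y i - x i)"
        using jk j by (intro sum_strict_mono_ex1) (auto simp: incr_def intro!: bexI[of _ j])
      moreover have "incr x j i \<le> y i" for i using less.prems(3)[of i] j by (auto simp: incr_def)
      ultimately have "(shape k (incr x j), shape k y) \<in> ?E\<^sup>+"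
        using False less.prems jk by (intro less.hyps) (auto simp: crystal_states_incr)
      then show ?thesis using e by (rule trancl_into_trancl2[rotated])
    qed
  qed
  have reach: "(h, h') \<in> ?E\<^sup>+" if "h \<in> ?S" "h' \<in> ?S" for h h'
  proof -
    define x where "x = shape_rep k h"
    define t where "t = Suc (\<Sum>i\<in>{1..k}. x i)"
    define y where "y i = (if i \<in> {1..k} then shape_rep k h' i + t else 0)" for i
    have x: "x \<in> crystal_states k" "shape k x = h" unfolding x_def using shape_rep[OF that(1)] by auto
    have "shape k (shape_rep k h') = shape k y"
      unfolding shape_eq_iff_shift by (auto simp: y_def)
    then have y: "y \<in> crystal_states k" "shape k y = h'"
      using shape_rep[OF that(2)] by (auto simp: y_def crystal_states_def)
    have lt: "x i < y i" if "i \<in> {1..k}" for i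
    proof -
      have "x i \<le> (\<Sum>i\<in>{1..k}. x i)" using that by (intro member_le_sum) auto
      then show ?thesis using that by (simp add: y_def t_def)
    qed
    have "x i \<le> y i" for i
      using lt[of i] crystal_states_outside[OF x(1), of i] by (cases "i \<in> {1..k}") auto
    moreover have "x \<noteq> y" using lt[of 1] k by auto
    ultimately show ?thesis using path[OF x(1) y(1)] x y by auto
  qed
  define C where "C = {h :: nat \<Rightarrow> int. \<forall>i. (i \<in> {1..<k} \<longrightarrow> h i \<in> {- int M..int M}) \<and> (i \<notin> {1..<k} \<longrightarrow> h i = 0)}"
  have "finite C" unfolding C_def by (intro finite_set_of_finite_funs) auto
  show ?thesis
    unfolding shape_ergodic_def
  proof
    fix i assume "i \<in> ?S"
    then show "positive_recurrent ?Q i"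
    proof (rule foster_positive_recurrent[where V = "\<lambda>h. V (shape_rep k h)" and C = C and hi = "real k * b1"])
      show "finite C" by fact
      fix h assume h: "h \<in> ?S"
      let ?x = "shape_rep k h"
      note x = shape_rep[OF h]
      show "0 \<le> V ?x" by (rule V_nonneg) (rule x)
      show "(h, i) \<in> ?E\<^sup>+" by (rule reach) fact+
      have "total h = (\<Sum>j\<in>{1..k}. ?r ?x j)" using sum_N[of h "\<lambda>_. 1"] by (simp add: total_def)
      also have "\<dots> \<le> (\<Sum>j\<in>{1..k}. b1)" using b by (intro sum_mono crystal_rate_le)
      finally show "total h \<le> real k * b1" by simp
      assume "h \<notin> C"
      then obtain l where l: "\<not> ((l \<in> {1..<k} \<longrightarrow> h l \<in> {- int M..int M}) \<and> (l \<notin> {1..<k} \<longrightarrow> h l = 0))"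
        by (auto simp: C_def)
      then have lk: "l \<in> {1..<k}" using h by (cases "l = 0 \<or> k \<le> l") (auto simp: shape_states_def)
      then have "1 \<le> l \<and> l \<le> k - 1" by auto
      then have "h l = int (?x l) - int (?x (l + 1))" using fun_cong[OF x(2), of l] by (auto simp: shape_def)
      then have "?x l + M \<le> ?x (l + 1) \<or> ?x (l + 1) + M \<le> ?x l" using l lk by auto
      then have "(\<Sum>j\<in>{1..k}. ?r ?x j * (V (incr ?x j) - V ?x)) \<le> -1"
        using drift[OF x(1), of l "l + 1"] drift[OF x(1), of "l + 1" l] lk by auto
      moreover have "V (shape_rep k (shape k (incr ?x j))) = V (incr ?x j)" if "j \<in> {1..k}" for j
        using that x by (intro V_shape) (auto simp: shape_rep shape_in_shape_states crystal_states_incr)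
      ultimately show "(\<Sum>y\<in>N h. ?Q h y * (V (shape_rep k y) - V ?x)) \<le> -1"
        by (subst sum_N) simp
    qed
  qed
qed

definition reflect :: "nat \<Rightarrow> (nat \<Rightarrow> nat) \<Rightarrow> nat \<Rightarrow> nat" where
  "reflect k x i = x (k + 1 - i)"

lemma crystal_states_reflect: "x \<in> crystal_states k \<Longrightarrow> reflect k x \<in> crystal_states k"
  by (auto simp: crystal_states_def reflect_def)

lemma reflect_incr: "j \<in> {1..k} \<Longrightarrow> reflect k (incr x j) = incr (reflect k x) (k + 1 - j)"
  by (rule ext) (auto simp: reflect_def incr_def)

lemma crystal_rate_reflect:
  assumes "j \<in> {1..k}"
  shows "crystal_rate b0 b1 b2 (reflect k x) (k + 1 - j) = crystal_rate b0 b1 b2 x j"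
proof -
  have "k + 1 - (k + 1 - j - 1) = j + 1" "k + 1 - (k + 1 - j + 1) = j - 1" "k + 1 - (k + 1 - j) = j"
    using assms by auto
  then have "Vnum (reflect k x) (k + 1 - j) = Vnum x j" by (simp only: Vnum_def reflect_def add.commute)
  then show ?thesis by (simp add: crystal_rate_def)
qed

definition crystal_gen ::
    "real \<Rightarrow> real \<Rightarrow> real \<Rightarrow> nat set \<Rightarrow> ((nat \<Rightarrow> nat) \<Rightarrow> real) \<Rightarrow> (nat \<Rightarrow> nat) \<Rightarrow> real" where
  "crystal_gen b0 b1 b2 R g x = (\<Sum>j\<in>R. crystal_rate b0 b1 b2 x j * (g (incr x j) - g x))"

lemma crystal_gen_reflect:
  "crystal_gen b0 b1 b2 {1..k} (\<lambda>x. g (reflect k x)) x = crystal_gen b0 b1 b2 {1..k} g (reflect k x)"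
  unfolding crystal_gen_def
  by (rule sum.reindex_bij_witness[of _ "\<lambda>j. k + 1 - j" "\<lambda>j. k + 1 - j"])
    (use crystal_rate_reflect[of _ k b0 b1 b2 x] in \<open>auto simp: reflect_incr\<close>)

text \<open>Smoothed maxima of the heights on the block \<open>{b<..k}\<close> whose growth speed is at most \<open>v\<close>
  while the site \<open>b\<close> lies below the block.\<close>

definition top_fn ::
    "real \<Rightarrow> real \<Rightarrow> real \<Rightarrow> nat \<Rightarrow> nat \<Rightarrow> real \<Rightarrow> real \<Rightarrow> ((nat \<Rightarrow> nat) \<Rightarrow> real) \<Rightarrow> bool" where
  "top_fn b0 b1 b2 k b C v \<Phi> \<longleftrightarrow>
     (\<forall>x. \<forall>i\<in>{b<..k}. real (x i) \<le> \<Phi> x) \<and>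
     (\<forall>x. \<exists>i\<in>{b<..k}. \<Phi> x \<le> real (x i) + C) \<and>
     (\<forall>x y t. (\<forall>i\<in>{b<..k}. real (y i) = real (x i) + t) \<longrightarrow> \<Phi> y = \<Phi> x + t) \<and>
     (\<forall>x\<in>crystal_states k. x b < x (b + 1) \<longrightarrow> crystal_gen b0 b1 b2 {b<..k} \<Phi> x \<le> v)"

lemma exp_minus_one_le:
  fixes u :: real
  assumes "\<bar>u\<bar> \<le> 1"
  shows "exp u - 1 \<le> u + u\<^sup>2"
proof (cases "0 \<le> u")
  case True
  then show ?thesis using exp_bound[of u] assms by simp
next
  case False
  then have "exp u \<le> 1 / (1 - u)"
    using exp_ge_add_one_self[of "- u"] by (simp add: exp_minus field_simps)
  also have "\<dots> \<le> 1 + u + u\<^sup>2"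
  proof -
    have "1 \<le> (1 + u + u\<^sup>2) * (1 - u)"
      using False mult_nonpos_nonneg[of u "u\<^sup>2"] by (simp add: algebra_simps power2_eq_square)
    then show ?thesis using False by (simp add: divide_le_eq)
  qed
  finally show ?thesis by simp
qed

lemma exp_drift_bounds:
  fixes r d :: "'a \<Rightarrow> real"
  assumes K: "0 < K" "D \<le> K" and d: "\<And>j. j \<in> J \<Longrightarrow> \<bar>d j\<bar> \<le> D"
    and r: "\<And>j. j \<in> J \<Longrightarrow> 0 \<le> r j \<and> r j \<le> B"
  shows "(\<Sum>j\<in>J. r j * (exp (d j / K) - 1)) \<le> (\<Sum>j\<in>J. r j * d j) / K + real (card J) * B * (D / K)\<^sup>2"
    and "0 \<le> B \<Longrightarrow> (\<Sum>j\<in>J. r j * (exp (d j / K) - 1)) \<le> real (card J) * (B * 3)"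
proof -
  have u: "\<bar>d j / K\<bar> \<le> D / K" "\<bar>d j / K\<bar> \<le> 1" if "j \<in> J" for j
    using d[OF that] K by (auto simp: abs_divide divide_le_eq divide_right_mono)
  have "(\<Sum>j\<in>J. r j * (exp (d j / K) - 1)) \<le> (\<Sum>j\<in>J. r j * d j / K + B * (D / K)\<^sup>2)"
  proof (rule sum_mono)
    fix j assume j: "j \<in> J"
    have "r j * (exp (d j / K) - 1) \<le> r j * (d j / K + (d j / K)\<^sup>2)"
      using r[OF j] u[OF j] by (intro mult_left_mono exp_minus_one_le) auto
    also have "\<dots> = r j * d j / K + r j * (d j / K)\<^sup>2" by (simp add: algebra_simps)
    also have "r j * (d j / K)\<^sup>2 \<le> B * (D / K)\<^sup>2"
      using r[OF j] u[OF j] abs_le_square_iff[of "d j / K" "D / K"] 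
      by (intro mult_mono zero_le_power2) linarith+
    finally show "r j * (exp (d j / K) - 1) \<le> r j * d j / K + B * (D / K)\<^sup>2" by simp
  qed
  then show "(\<Sum>j\<in>J. r j * (exp (d j / K) - 1)) \<le> (\<Sum>j\<in>J. r j * d j) / K + real (card J) * B * (D / K)\<^sup>2"
    by (simp add: sum.distrib sum_divide_distrib)
  assume "0 \<le> B"
  have "(\<Sum>j\<in>J. r j * (exp (d j / K) - 1)) \<le> (\<Sum>j\<in>J. B * 3)"
  proof (rule sum_mono)
    fix j assume j: "j \<in> J"
    have "exp (d j / K) \<le> exp 1" using u[OF j] by (intro exp_le_cancel_iff[THEN iffD2]) linarith
    then have "exp (d j / K) - 1 \<le> 3" using exp_le by linarith
    then have "r j * (exp (d j / K) - 1) \<le> r j * 3" using r[OF j] by (intro mult_left_mono) auto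
    also have "\<dots> \<le> B * 3" using r[OF j] by (intro mult_right_mono) auto
    finally show "r j * (exp (d j / K) - 1) \<le> B * 3" .
  qed
  then show "(\<Sum>j\<in>J. r j * (exp (d j / K) - 1)) \<le> real (card J) * (B * 3)" by simp
qed

lemma sum_exp_drift_le:
  fixes F :: "'a \<Rightarrow> real"
  assumes "finite P" and "p \<in> P" and K: "0 < K" and \<epsilon>: "0 \<le> \<epsilon>" and \<Gamma>: "0 \<le> \<Gamma>" and T: "0 \<le> T"
    and active: "\<And>q. q \<in> P \<Longrightarrow> F p - T \<le> F q \<Longrightarrow> G q \<le> - \<epsilon> * exp (F q / K)"
    and crude: "\<And>q. q \<in> P \<Longrightarrow> G q \<le> \<Gamma> * exp (F q / K)"
  shows "sum G P \<le> (- \<epsilon> + real (card P) * \<Gamma> * exp (- T / K)) * exp (F p / K)"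
proof -
  have *: "G q \<le> \<Gamma> * exp (- T / K) * exp (F p / K)" if "q \<in> P" for q
  proof (cases "F p - T \<le> F q")
    case True
    then have "G q \<le> - \<epsilon> * exp (F q / K)" using active that by blast
    also have "\<dots> \<le> 0" using \<epsilon> by simp
    also have "\<dots> \<le> \<Gamma> * exp (- T / K) * exp (F p / K)" using \<Gamma> by simp
    finally show ?thesis .
  next
    case False
    have "G q \<le> \<Gamma> * exp (F q / K)" using crude that by blast
    also have "\<dots> \<le> \<Gamma> * exp ((- T + F p) / K)"
      using False \<Gamma> K by (intro mult_left_mono exp_le_cancel_iff[THEN iffD2] divide_right_mono) auto
    also have "\<dots> = \<Gamma> * exp (- T / K) * exp (F p / K)"
      unfolding add_divide_distrib exp_add by (simp only: mult.assoc)
    finally show ?thesis .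
  qed
  have "sum G P = G p + sum G (P - {p})" using assms(1,2) by (simp add: sum.remove)
  also have "\<dots> \<le> - \<epsilon> * exp (F p / K) + (\<Sum>q\<in>P - {p}. \<Gamma> * exp (- T / K) * exp (F p / K))"
    using active[OF \<open>p \<in> P\<close>] T * by (intro add_mono sum_mono) auto
  also have "(\<Sum>q\<in>P - {p}. \<Gamma> * exp (- T / K) * exp (F p / K)) \<le> (\<Sum>q\<in>P. \<Gamma> * exp (- T / K) * exp (F p / K))"
    using \<Gamma> assms(1) by (intro sum_mono2) auto
  finally show ?thesis by (simp add: algebra_simps)
qed

lemma ergodic_if_top_fns:
  fixes C :: real and v :: "nat \<Rightarrow> real" and \<Phi> :: "nat \<Rightarrow> (nat \<Rightarrow> nat) \<Rightarrow> real"
  assumes k: "2 \<le> k" and b: "0 < b0" "b0 < b2" "b2 < b1"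
    and top: "\<And>b. b \<in> {1..<k} \<Longrightarrow> top_fn b0 b1 b2 k b C (v b) (\<Phi> b)"
    and C: "0 \<le> C"
    and v1: "v 1 < b1" and v2: "\<And>b. b \<in> {2..<k} \<Longrightarrow> v b < b2"
  shows "shape_ergodic b0 b1 b2 k"
proof -
  let ?r = "crystal_rate b0 b1 b2"
  define \<delta> where "\<delta> = Min (insert (b1 - v 1) ((\<lambda>b. b2 - v b) ` {2..<k}))"
  have \<delta>: "0 < \<delta>" unfolding \<delta>_def using v1 v2 by (subst Min_gr_iff) auto
  have \<delta>1: "v 1 + \<delta> \<le> b1"
    using Min_le[of "insert (b1 - v 1) ((\<lambda>b. b2 - v b) ` {2..<k})" "b1 - v 1"] unfolding \<delta>_def[symmetric] by simp
  have \<delta>2: "v b + \<delta> \<le> b2" if "b \<in> {2..<k}" for b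
    using Min_le[of "insert (b1 - v 1) ((\<lambda>b. b2 - v b) ` {2..<k})" "b2 - v b"] that
    unfolding \<delta>_def[symmetric] by auto
  define D where "D = C + 1"
  have D: "1 \<le> D" using C by (simp add: D_def)
  define K where "K = max D (2 * (real k * b1 * D\<^sup>2) / \<delta>)"
  have K: "0 < K" "D \<le> K" using D by (auto simp: K_def)
  have Kd: "real k * b1 * (D / K)\<^sup>2 \<le> \<delta> / (2 * K)"
  proof -
    have "2 * (real k * b1 * D\<^sup>2) / \<delta> \<le> K" by (simp add: K_def)
    then show ?thesis using \<delta> K by (simp add: field_simps power2_eq_square)
  qed
  define \<Gamma> where "\<Gamma> = real k * (b1 * 3)"
  have \<Gamma>: "0 < \<Gamma>" using k b by (simp add: \<Gamma>_def)
  define T where "T = K * (8 * real k * \<Gamma> * K / \<delta>)"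
  have T: "0 \<le> T" using K \<Gamma> \<delta> by (simp add: T_def)
  have T_bound: "2 * real k * \<Gamma> * exp (- T / K) \<le> \<delta> / (4 * K)"
  proof -
    have "8 * real k * \<Gamma> * K / \<delta> = T / K" using K by (simp add: T_def)
    also have "\<dots> \<le> exp (T / K)" using exp_ge_add_one_self[of "T / K"] by linarith
    finally have "8 * real k * \<Gamma> * K / \<delta> \<le> exp (T / K)" .
    then show ?thesis using K \<delta> by (simp add: exp_minus field_simps)
  qed
  define a where "a = C + T + 1"
  define M where "M = nat \<lceil>C + a * real k + T + 1 + 4 * K\<^sup>2 / \<delta>\<rceil>"
  have M: "C + a * real k + T + 1 + 4 * K\<^sup>2 / \<delta> \<le> real M"
    by (simp add: M_def real_nat_ceiling_ge)
  have a: "0 \<le> a" "0 \<le> a * real k" and KK: "0 \<le> 4 * K\<^sup>2 / \<delta>"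
    using C T \<delta> by (auto simp: a_def)
  define f where "f b x = \<Phi> b x - real (x b) + a * real b" for b and x :: "nat \<Rightarrow> nat"
  have lower: "real (x i) \<le> \<Phi> b x" if "b \<in> {1..<k}" "i \<in> {b<..k}" for b i x
    using top[OF that(1)] that(2) by (auto simp: top_fn_def)
  have upper: "\<exists>i\<in>{b<..k}. \<Phi> b x \<le> real (x i) + C" if "b \<in> {1..<k}" for b x
    using top[OF that] by (auto simp: top_fn_def)
  have shift: "\<Phi> b y = \<Phi> b x + t" if "b \<in> {1..<k}" "\<And>i. i \<in> {b<..k} \<Longrightarrow> real (y i) = real (x i) + t" for b x y t
    using top[OF that(1)] that(2) unfolding top_fn_def by blast
  have gen: "crystal_gen b0 b1 b2 {b<..k} (\<Phi> b) x \<le> v b"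
    if "b \<in> {1..<k}" "x \<in> crystal_states k" "x b < x (b + 1)" for b x
    using top[OF that(1)] that(2,3) unfolding top_fn_def by blast
  have r: "0 \<le> ?r x j \<and> ?r x j \<le> b1" for x j
    using crystal_rate_pos[of b0 b1 b2 x j] crystal_rate_le[of b0 b1 b2 x j] b by auto
  have \<Phi>_outside: "\<Phi> b (incr x j) = \<Phi> b x" if "b \<in> {1..<k}" "j \<notin> {b<..k}" for b x j
    using shift[of b "incr x j" x 0] that by (auto simp: incr_def)
  have \<Phi>_incr: "\<bar>\<Phi> b (incr x j) - \<Phi> b x\<bar> \<le> D" if bk: "b \<in> {1..<k}" for b x j
  proof -
    obtain i where i: "i \<in> {b<..k}" "\<Phi> b x \<le> real (x i) + C" using upper[OF bk] by blast
    obtain i' where i': "i' \<in> {b<..k}" "\<Phi> b (incr x j) \<le> real (incr x j i') + C" using upper[OF bk] by blast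
    show ?thesis
      using i i' lower[OF bk i(1), of "incr x j"] lower[OF bk i'(1), of x]
      by (auto simp: D_def incr_def split: if_splits)
  qed
  have f_incr: "f b (incr x j) - f b x =
      (if j = b then -1 else if j \<in> {b<..k} then \<Phi> b (incr x j) - \<Phi> b x else 0)"
    if "b \<in> {1..<k}" for b x j
    using \<Phi>_outside[OF that, of j x] by (auto simp: f_def incr_def)
  have d: "\<bar>f b (incr x j) - f b x\<bar> \<le> D" if "b \<in> {1..<k}" for b x j
    using \<Phi>_incr[OF that, of x j] D by (auto simp: f_incr[OF that])
  let ?E = "\<lambda>b x. exp (f b x / K)"
  let ?G = "crystal_gen b0 b1 b2 {1..k}"
  have G_eq: "?G (?E b) x = (\<Sum>j\<in>{1..k}. ?r x j * (exp ((f b (incr x j) - f b x) / K) - 1)) * ?E b x" for b x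
    unfolding crystal_gen_def sum_distrib_right
    by (intro sum.cong refl) (simp add: left_diff_distrib diff_divide_distrib exp_diff)
  have crude: "?G (?E b) x \<le> \<Gamma> * ?E b x" if "b \<in> {1..<k}" for b x
    using exp_drift_bounds(2)[OF K, of "{1..k}" "\<lambda>j. f b (incr x j) - f b x" "?r x" b1] d[OF that] r b
    unfolding G_eq \<Gamma>_def by (intro mult_right_mono) auto
  have good: "?G (?E b) x \<le> - (\<delta> / (2 * K)) * ?E b x"
    if bk: "b \<in> {1..<k}" and x: "x \<in> crystal_states k" "x b < x (b + 1)" for b x
  proof -
    have "(\<Sum>j\<in>{1..k}. ?r x j * (f b (incr x j) - f b x)) =
        (\<Sum>j\<in>insert b {b<..k}. ?r x j * (f b (incr x j) - f b x))"
      using bk by (intro sum.mono_neutral_right) (auto simp: f_incr)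
    also have "\<dots> = - ?r x b + crystal_gen b0 b1 b2 {b<..k} (\<Phi> b) x"
      using bk by (simp add: f_incr crystal_gen_def)
    also have "\<dots> \<le> - ?r x b + v b" using gen[OF bk x] by simp
    also have "\<dots> \<le> - \<delta>"
    proof (cases "b = 1")
      case True
      then have "?r x b = b1" using x crystal_states_outside[OF x(1), of 0]
        by (simp add: crystal_rate_def beta_def Vnum_def)
      then show ?thesis using \<delta>1 True by simp
    next
      case False
      have "b2 \<le> ?r x b" using x b by (simp add: crystal_rate_def beta_def Vnum_def)
      then show ?thesis using \<delta>2[of b] False bk by auto
    qed
    finally have "(\<Sum>j\<in>{1..k}. ?r x j * (f b (incr x j) - f b x)) / K \<le> - \<delta> / K"
      using K by (intro divide_right_mono) auto
    moreover have "(\<Sum>j\<in>{1..k}. ?r x j * (exp ((f b (incr x j) - f b x) / K) - 1)) \<le>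
        (\<Sum>j\<in>{1..k}. ?r x j * (f b (incr x j) - f b x)) / K + real k * b1 * (D / K)\<^sup>2"
      using exp_drift_bounds(1)[OF K, of "{1..k}" "\<lambda>j. f b (incr x j) - f b x" "?r x" b1] d[OF bk] r by auto
    moreover have "- \<delta> / K + \<delta> / (2 * K) = - (\<delta> / (2 * K))" using K by (simp add: field_simps)
    ultimately have "(\<Sum>j\<in>{1..k}. ?r x j * (exp ((f b (incr x j) - f b x) / K) - 1)) \<le> - (\<delta> / (2 * K))"
      using Kd by linarith
    then show ?thesis unfolding G_eq by (intro mult_right_mono) auto
  qed
  define P where "P = {1..<k} \<times> (UNIV :: bool set)"
  define w where "w s x = (if s then reflect k x else x)" for s :: bool and x
  define F where "F x q = f (fst q) (w (snd q) x)" for x q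
  define V where "V x = (\<Sum>q\<in>P. exp (F x q / K))" for x
  have P: "finite P" "card P \<le> 2 * k" "P \<noteq> {}"
    using k by (auto simp: P_def card_cartesian_product)
  have w_states: "w s x \<in> crystal_states k" if "x \<in> crystal_states k" for s x
    using that by (simp add: w_def crystal_states_reflect)
  have G_V: "?G V x = (\<Sum>q\<in>P. ?G (?E (fst q)) (w (snd q) x))" for x
  proof -
    have "?G V x = (\<Sum>q\<in>P. ?G (\<lambda>x. exp (F x q / K)) x)"
      unfolding crystal_gen_def V_def sum_subtractf[symmetric] sum_distrib_left by (rule sum.swap)
    also have "\<dots> = (\<Sum>q\<in>P. ?G (?E (fst q)) (w (snd q) x))"
    proof (rule sum.cong)
      fix q :: "nat \<times> bool"
      show "?G (\<lambda>x. exp (F x q / K)) x = ?G (?E (fst q)) (w (snd q) x)"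
        using crystal_gen_reflect[of b0 b1 b2 k "?E (fst q)" x]
        by (cases "snd q") (simp_all add: F_def w_def)
    qed simp
    finally show ?thesis .
  qed
  show ?thesis
  proof (rule shape_ergodicI[OF k, of b0 b1 b2 V M])
    show "0 < b0" "0 < b1" "0 < b2" "b0 \<le> b1" "b2 \<le> b1" using b by auto
    show "0 \<le> V x" for x by (auto simp: V_def intro!: sum_nonneg)
    fix x y :: "nat \<Rightarrow> nat" and p q
    assume x: "x \<in> crystal_states k"
    {
      assume "shape k x = shape k y"
      then obtain t where t: "\<And>i. i \<in> {1..k} \<Longrightarrow> int (y i) = int (x i) + t"
        unfolding shape_eq_iff_shift by auto
      have t': "real (y i) = real (x i) + of_int t" if "i \<in> {1..k}" for i
        using arg_cong[OF t[OF that], of real_of_int] by simp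
      have "F x q = F y q" if "q \<in> P" for q
      proof -
        have bk: "fst q \<in> {1..<k}" using that by (auto simp: P_def)
        have tw: "real (w s y i) = real (w s x i) + of_int t" if "i \<in> {1..k}" for i s
        proof -
          have "k + 1 - i \<in> {1..k}" using that by auto
          then show ?thesis using that t'[of i] t'[of "k + 1 - i"] by (simp add: w_def reflect_def)
        qed
        show ?thesis
          using shift[OF bk, of "w (snd q) y" "w (snd q) x" "of_int t"] tw[of "fst q" "snd q"]
            tw[of _ "snd q"] bk
          by (auto simp: F_def f_def)
      qed
      then show "V x = V y" by (simp add: V_def)
    }
    assume pq: "p \<in> {1..k}" "q \<in> {1..k}" "x p + M \<le> x q"
    have "Max (F x ` P) \<in> F x ` P" using P by (intro Max_in) auto
    then obtain m where m': "m \<in> P" "Max (F x ` P) = F x m" by auto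
    have m: "m \<in> P" "\<And>q. q \<in> P \<Longrightarrow> F x q \<le> F x m"
      using m'(1) P(1) by (auto simp flip: m'(2))
    have "0 < real M" using M C T a KK by linarith
    then have "p \<noteq> q" using pq by auto
    have big: "real M \<le> F x m"
    proof (cases "p < q")
      case True
      have "real M \<le> F x (p, False)"
        using lower[of p q x] True pq a by (auto simp: F_def w_def f_def intro!: add_increasing2)
      also have "\<dots> \<le> F x m" using True pq by (intro m) (auto simp: P_def)
      finally show ?thesis .
    next
      case False
      then have "q < p" using \<open>p \<noteq> q\<close> by simp
      then have pq': "k + 1 - p \<in> {1..<k}" "k + 1 - q \<in> {k + 1 - p<..k}" using pq by auto
      have "real M \<le> F x (k + 1 - p, True)"
        using lower[of "k + 1 - p" "k + 1 - q" "reflect k x", OF pq'] \<open>q < p\<close> pq a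
        by (auto simp: F_def w_def f_def reflect_def intro!: add_increasing2)
      also have "\<dots> \<le> F x m" using \<open>q < p\<close> pq by (intro m) (auto simp: P_def)
      finally show ?thesis .
    qed
    have active: "?G (?E (fst q)) (w (snd q) x) \<le> - (\<delta> / (2 * K)) * exp (F x q / K)"
      if q: "q \<in> P" "F x m - T \<le> F x q" for q
    proof -
      define b where "b = fst q"
      define y where "y = w (snd q) x"
      have bk: "b \<in> {1..<k}" using q by (auto simp: P_def b_def)
      have F: "F x q = f b y" by (simp add: F_def b_def y_def)
      have "y b < y (b + 1)"
      proof (rule ccontr)
        assume "\<not> y b < y (b + 1)"
        then have le: "y (b + 1) \<le> y b" by simp
        obtain i where i: "i \<in> {b<..k}" "\<Phi> b y \<le> real (y i) + C" using upper[OF bk] by blast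
        have "a * real b \<le> a * real k" using bk a by (intro mult_left_mono) auto
        then have "real (y b) < real (y i)"
          using F q(2) big M i(2) KK unfolding f_def by linarith
        then have "y b < y i" by simp
        then have "i \<noteq> b + 1" using le by auto
        then have i': "i \<in> {b + 1<..k}" and bk': "b + 1 \<in> {1..<k}" using i(1) by auto
        have "F x (b + 1, snd q) \<le> F x m" using bk' by (intro m) (auto simp: P_def)
        moreover have "F x (b + 1, snd q) = \<Phi> (b + 1) y - real (y (b + 1)) + a * real b + a"
          by (simp add: F_def f_def y_def algebra_simps)
        moreover have "F x q = \<Phi> b y - real (y b) + a * real b" unfolding F f_def ..
        ultimately show False using lower[OF bk' i', of y] i(2) le q(2) by (simp add: a_def)
      qed
      then show ?thesis using good[OF bk, of y] w_states[OF x, of "snd q"] by (simp add: F b_def y_def)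
    qed
    have "?G V x \<le> (- (\<delta> / (2 * K)) + real (card P) * \<Gamma> * exp (- T / K)) * exp (F x m / K)"
      unfolding G_V using \<delta> K T \<Gamma> active crude
      by (intro sum_exp_drift_le[where F = "F x", OF P(1) m(1)]) (auto simp: F_def P_def)
    also have "\<dots> \<le> (- (\<delta> / (4 * K))) * exp (F x m / K)"
    proof (intro mult_right_mono)
      have "real (card P) * \<Gamma> * exp (- T / K) \<le> 2 * real k * \<Gamma> * exp (- T / K)"
        using P(2) \<Gamma> by (intro mult_right_mono) auto
      moreover have "- (\<delta> / (2 * K)) + \<delta> / (4 * K) = - (\<delta> / (4 * K))" by (simp add: field_simps)
      ultimately show "- (\<delta> / (2 * K)) + real (card P) * \<Gamma> * exp (- T / K) \<le> - (\<delta> / (4 * K))"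
        using T_bound by linarith
    qed simp
    also have "\<dots> \<le> - 1"
    proof -
      have "4 * K\<^sup>2 / \<delta> \<le> F x m" using big M C T a by linarith
      then have "4 * K / \<delta> \<le> F x m / K" using K \<delta> by (simp add: field_simps power2_eq_square)
      also have "\<dots> \<le> exp (F x m / K)" using exp_ge_add_one_self[of "F x m / K"] by linarith
      finally show ?thesis using K \<delta> by (simp add: field_simps)
    qed
    finally show "(\<Sum>j\<in>{1..k}. ?r x j * (V (incr x j) - V x)) \<le> - 1" by (simp add: crystal_gen_def)
  qed
qed

lemma crystal_rate_at_max:
  assumes "x \<in> crystal_states k" and "x b < x (b + 1)" and "j \<in> {b<..k}"
    and max: "\<And>i. i \<in> {b<..k} \<Longrightarrow> x i \<le> x j"
  shows "crystal_rate b0 b1 b2 x j = b0"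
proof -
  have "x (j - 1) \<le> x j"
  proof (cases "j = b + 1")
    case False
    then show ?thesis using assms(3) by (intro max) auto
  qed (use assms(2) in auto)
  moreover have "x (j + 1) \<le> x j"
  proof (cases "j = k")
    case True
    then show ?thesis using crystal_states_outside[OF assms(1), of "j + 1"] by simp
  next
    case False
    then show ?thesis using assms(3) by (intro max) auto
  qed
  ultimately show ?thesis by (simp add: crystal_rate_def beta_def Vnum_def)
qed

lemma ex_block_max:
  fixes x :: "nat \<Rightarrow> nat"
  assumes "b < k"
  obtains p where "p \<in> {b<..k}" and "\<And>i. i \<in> {b<..k} \<Longrightarrow> x i \<le> x p"
proof -
  have "Max (x ` {b<..k}) \<in> x ` {b<..k}" using assms by (intro Max_in) auto
  then obtain p where p: "p \<in> {b<..k}" "Max (x ` {b<..k}) = x p" by auto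
  show ?thesis
  proof (rule that[OF p(1)])
    show "x i \<le> x p" if "i \<in> {b<..k}" for i
      unfolding p(2)[symmetric] using that by (intro Max_ge) auto
  qed
qed

lemma top_fn_Max:
  assumes b: "0 < b0" "0 < b1" "0 < b2" and "b < k"
  shows "top_fn b0 b1 b2 k b 0 (real (k - b) * b0) (\<lambda>x. real (Max (x ` {b<..k})))"
proof -
  let ?R = "{b<..k}"
  have ne: "?R \<noteq> {}" using \<open>b < k\<close> by auto
  have upper: "\<exists>i\<in>?R. real (Max (x ` ?R)) \<le> real (x i) + 0" for x :: "nat \<Rightarrow> nat"
  proof -
    have "Max (x ` ?R) \<in> x ` ?R" using ne by (intro Max_in) auto
    then obtain i where i: "i \<in> ?R" "Max (x ` ?R) = x i" by auto
    show ?thesis unfolding i(2) using i(1) by auto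
  qed
  have shift: "real (Max (y ` ?R)) = real (Max (x ` ?R)) + t"
    if "\<forall>i\<in>?R. real (y i) = real (x i) + t" for x y :: "nat \<Rightarrow> nat" and t
  proof -
    obtain p where p: "p \<in> ?R" "\<And>i. i \<in> ?R \<Longrightarrow> x i \<le> x p" 
      using ex_block_max[OF \<open>b < k\<close>, of x] by blast
    have "y i \<le> y p" if "i \<in> ?R" for i
    proof -
      have "real (y i) \<le> real (y p)"
        using \<open>\<forall>i\<in>?R. _\<close>[rule_format, OF that] \<open>\<forall>i\<in>?R. _\<close>[rule_format, OF p(1)] p(2)[OF that] by simp
      then show ?thesis by simp
    qed
    then have "Max (x ` ?R) = x p" "Max (y ` ?R) = y p" using p by (auto intro!: Max_eqI)
    then show ?thesis using that p(1) by auto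
  qed
  have gen: "crystal_gen b0 b1 b2 ?R (\<lambda>x. real (Max (x ` ?R))) x \<le> real (k - b) * b0"
    if x: "x \<in> crystal_states k" "x b < x (b + 1)" for x
  proof -
    have "crystal_rate b0 b1 b2 x j * (real (Max (incr x j ` ?R)) - real (Max (x ` ?R))) \<le> b0"
      if j: "j \<in> ?R" for j
    proof (cases "x j = Max (x ` ?R)")
      case True
      then have "crystal_rate b0 b1 b2 x j = b0"
        by (intro crystal_rate_at_max[OF x j]) simp
      moreover have "Max (incr x j ` ?R) \<le> Max (x ` ?R) + 1"
      proof (intro Max.boundedI)
        fix a assume "a \<in> incr x j ` ?R"
        then obtain i where i: "i \<in> ?R" "a = incr x j i" by auto
        then have "x i \<le> Max (x ` ?R)" by (intro Max_ge) auto
        moreover have "a \<le> x i + 1" using i by (simp add: incr_def)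
        ultimately show "a \<le> Max (x ` ?R) + 1" by linarith
      qed (use ne in auto)
      ultimately show ?thesis using b by simp
    next
      case False
      moreover have "x j \<le> Max (x ` ?R)" using j by (intro Max_ge) auto
      ultimately have "x j + 1 \<le> Max (x ` ?R)" by linarith
      then have "Max (incr x j ` ?R) \<le> Max (x ` ?R)"
        using ne by (intro Max.boundedI) (auto simp: incr_def)
      then have "crystal_rate b0 b1 b2 x j * (real (Max (incr x j ` ?R)) - real (Max (x ` ?R))) \<le> 0"
        using crystal_rate_pos[OF b, of x j] by (intro mult_nonneg_nonpos) auto
      then show ?thesis using b by simp
    qed
    then have "crystal_gen b0 b1 b2 ?R (\<lambda>x. real (Max (x ` ?R))) x \<le> (\<Sum>j\<in>?R. b0)"
      unfolding crystal_gen_def by (rule sum_mono)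
    then show ?thesis by simp
  qed
  show ?thesis
    unfolding top_fn_def
  proof (intro conjI allI ballI impI)
    show "real (x i) \<le> real (Max (x ` ?R))" if "i \<in> ?R" for x :: "nat \<Rightarrow> nat" and i
      using that by simp
  qed (use upper shift gen in blast)+
qed

lemma crystal_gen_ln:
  assumes b: "0 < b0" "0 < b1" "0 < b2" and "0 < c" and U: "\<And>x. 0 < U x"
  shows "crystal_gen b0 b1 b2 R (\<lambda>x. c * ln (U x)) x \<le> c * (crystal_gen b0 b1 b2 R U x / U x)"
proof -
  have "crystal_rate b0 b1 b2 x j * (c * ln (U (incr x j)) - c * ln (U x)) \<le>
      c * (crystal_rate b0 b1 b2 x j * (U (incr x j) - U x) / U x)" for j
  proof -
    have "ln (U (incr x j)) - ln (U x) = ln (U (incr x j) / U x)"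
      using U[of x] U[of "incr x j"] by (simp add: ln_div)
    also have "\<dots> \<le> U (incr x j) / U x - 1"
      using U[of x] U[of "incr x j"] by (intro ln_le_minus_one) simp
    also have "\<dots> = (U (incr x j) - U x) / U x" using U[of x] by (simp add: field_simps)
    finally have "(crystal_rate b0 b1 b2 x j * c) * (ln (U (incr x j)) - ln (U x)) \<le>
        (crystal_rate b0 b1 b2 x j * c) * ((U (incr x j) - U x) / U x)"
      using crystal_rate_pos[OF b, of x j] \<open>0 < c\<close> by (intro mult_left_mono) auto
    then show ?thesis by (simp add: algebra_simps)
  qed
  then show ?thesis
    unfolding crystal_gen_def sum_divide_distrib sum_distrib_left by (rule sum_mono)
qed

text \<open>The weight \<open>\<kappa>\<close> per site makes every set that misses a highest site \<open>p\<close> negligible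
  against the set obtained by adding \<open>p\<close>; and a set containing \<open>p\<close> has one site growing at rate
  \<open>b0\<close>.\<close>

lemma top_fn_averages:
  assumes b: "0 < b0" "0 < b2" "b0 \<le> b1" "b2 \<le> b1" and "b < k" and \<epsilon>: "0 < \<epsilon>"
  shows "\<exists>C \<Phi>. top_fn b0 b1 b2 k b C (b1 - (b1 - b0) / real (k - b) + \<epsilon>) \<Phi>"
proof -
  let ?R = "{b<..k}" and ?r = "crystal_rate b0 b1 b2"
  define m where "m = k - b"
  have m: "0 < m" "card ?R = m" using \<open>b < k\<close> by (auto simp: m_def)
  have b1: "0 < b1" using b by simp
  define K where "K = max 1 (2 * (real m * b1) / \<epsilon>)"
  have K: "0 < K" "1 \<le> K" by (auto simp: K_def)
  have K\<epsilon>: "real m * b1 * (1 / K)\<^sup>2 \<le> \<epsilon> / 2 / K"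
  proof -
    have "2 * (real m * b1) / \<epsilon> \<le> K" by (simp add: K_def)
    then show ?thesis using \<epsilon> K by (simp add: field_simps power2_eq_square)
  qed
  define \<kappa> where "\<kappa> = K * (2 * b1 / \<epsilon>)"
  have \<kappa>: "0 \<le> \<kappa>" using K b1 \<epsilon> by (simp add: \<kappa>_def)
  have \<kappa>\<epsilon>: "b1 * exp (- \<kappa> / K) \<le> \<epsilon> / 2"
  proof -
    have "2 * b1 / \<epsilon> = \<kappa> / K" using K by (simp add: \<kappa>_def)
    also have "\<dots> \<le> exp (\<kappa> / K)" using exp_ge_add_one_self[of "\<kappa> / K"] by linarith
    finally show ?thesis using \<epsilon> by (simp add: exp_minus field_simps)
  qed
  define g where "g A x = (\<Sum>i\<in>A. real (x i)) / real (card A) + \<kappa> * real (card A)"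
    for A and x :: "nat \<Rightarrow> nat"
  define P where "P = Pow ?R - {{}}"
  define U where "U x = (\<Sum>A\<in>P. exp (g A x / K))" for x
  have P: "finite P" by (simp add: P_def)
  have A: "finite A" "0 < card A" "card A \<le> m" "A \<subseteq> ?R" if "A \<in> P" for A
  proof -
    show "A \<subseteq> ?R" using that by (auto simp: P_def)
    then show fin: "finite A" by (rule finite_subset) simp
    show "0 < card A" using fin that by (auto simp: P_def card_gt_0_iff)
    show "card A \<le> m" using card_mono[OF _ \<open>A \<subseteq> ?R\<close>] m by simp
  qed
  have single: "{i} \<in> P" if "i \<in> ?R" for i using that by (auto simp: P_def)
  have U_ge: "exp ((real (x i) + \<kappa>) / K) \<le> U x" if "i \<in> ?R" for i x
  proof -
    have "exp ((real (x i) + \<kappa>) / K) = exp (g {i} x / K)" by (simp add: g_def)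
    also have "\<dots> \<le> U x"
      unfolding U_def using P single[OF that] by (intro member_le_sum) auto
    finally show ?thesis .
  qed
  have U_pos: "0 < U x" for x
    using U_ge[of k x] \<open>b < k\<close> exp_gt_zero[of "(real (x k) + \<kappa>) / K"] by (auto intro: less_le_trans simp del: exp_gt_zero)
  define C where "C = \<kappa> * real m + K * ln (real (card P))"
  have cP: "0 < card P" using single[of k] P \<open>b < k\<close> by (auto simp: card_gt_0_iff)
  have g_le: "g A x \<le> real (x p) + \<kappa> * real m"
    if "A \<in> P" "\<And>i. i \<in> ?R \<Longrightarrow> x i \<le> x p" for A x p
  proof -
    have "(\<Sum>i\<in>A. real (x i)) \<le> (\<Sum>i\<in>A. real (x p))" using that A(4)[OF that(1)] by (intro sum_mono) auto
    then have "(\<Sum>i\<in>A. real (x i)) / real (card A) \<le> real (x p)"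
      using A(2)[OF that(1)] by (simp add: field_simps)
    moreover have "\<kappa> * real (card A) \<le> \<kappa> * real m" using A(3)[OF that(1)] \<kappa> by (intro mult_left_mono) auto
    ultimately show ?thesis by (simp add: g_def)
  qed
  have upper: "\<exists>i\<in>?R. K * ln (U x) \<le> real (x i) + C" for x
  proof -
    obtain p where p: "p \<in> ?R" "\<And>i. i \<in> ?R \<Longrightarrow> x i \<le> x p" 
      using ex_block_max[OF \<open>b < k\<close>, of x] by blast
    have "U x \<le> (\<Sum>A\<in>P. exp ((real (x p) + \<kappa> * real m) / K))"
      unfolding U_def using g_le[of _ x p] p(2) K
      by (intro sum_mono exp_le_cancel_iff[THEN iffD2] divide_right_mono) auto
    then have "U x \<le> real (card P) * exp ((real (x p) + \<kappa> * real m) / K)" by simp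
    then have "ln (U x) \<le> ln (real (card P) * exp ((real (x p) + \<kappa> * real m) / K))"
      using U_pos[of x] by (intro ln_mono) auto
    also have "\<dots> = ln (real (card P)) + (real (x p) + \<kappa> * real m) / K"
      using cP by (simp add: ln_mult)
    finally have "K * ln (U x) \<le> K * (ln (real (card P)) + (real (x p) + \<kappa> * real m) / K)"
      using K by (intro mult_left_mono) auto
    also have "\<dots> = real (x p) + C" using K by (simp add: C_def field_simps)
    finally show ?thesis using p(1) by blast
  qed
  have lower: "real (x i) \<le> K * ln (U x)" if "i \<in> ?R" for i x
  proof -
    have "(real (x i) + \<kappa>) / K \<le> ln (U x)" using U_ge[OF that] U_pos[of x] by (simp add: ln_ge_iff)
    then have "real (x i) + \<kappa> \<le> K * ln (U x)" using K by (simp add: field_simps)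
    then show ?thesis using \<kappa> by simp
  qed
  have shift: "K * ln (U y) = K * ln (U x) + t" if "\<forall>i\<in>?R. real (y i) = real (x i) + t" for x y t
  proof -
    have "g A' y = g A' x + t" if "A' \<in> P" for A'
    proof -
      have "(\<Sum>i\<in>A'. real (y i)) = (\<Sum>i\<in>A'. real (x i) + t)"
        using A(4)[OF that] \<open>\<forall>i\<in>?R. _\<close> by (intro sum.cong) auto
      then show ?thesis using A(2)[OF that] by (simp add: g_def sum.distrib field_simps)
    qed
    then have "U y = (\<Sum>A\<in>P. exp (t / K) * exp (g A x / K))"
      unfolding U_def by (intro sum.cong) (auto simp: add_divide_distrib exp_add)
    then have "U y = exp (t / K) * U x" by (simp add: U_def sum_distrib_left)
    then have "ln (U y) = t / K + ln (U x)" using U_pos[of x] by (simp add: ln_mult)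
    then show ?thesis using K by (simp add: field_simps)
  qed
  have gen: "crystal_gen b0 b1 b2 ?R (\<lambda>x. K * ln (U x)) x \<le> b1 - (b1 - b0) / real (k - b) + \<epsilon>"
    if x: "x \<in> crystal_states k" "x b < x (b + 1)" for x
  proof -
    define v where "v = b1 - (b1 - b0) / real m"
    have v: "0 \<le> v"
    proof -
      have "(b1 - b0) / real m \<le> b1 - b0" using m b by (simp add: divide_le_eq mult_le_cancel_left1)
      then show ?thesis using b by (simp add: v_def)
    qed
    obtain p where p: "p \<in> ?R" "\<And>i. i \<in> ?R \<Longrightarrow> x i \<le> x p" 
      using ex_block_max[OF \<open>b < k\<close>, of x] by blast
    have r: "0 \<le> ?r x j \<and> ?r x j \<le> b1" for j
      using crystal_rate_pos[of b0 b1 b2 x j] crystal_rate_le[of b0 b1 b2 x j] b b1 by auto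
    have r_p: "?r x p = b0" by (rule crystal_rate_at_max[OF x p])
    let ?e = "\<lambda>A. exp (g A x / K)"
    have incr_g: "g A (incr x j) - g A x = (if j \<in> A then 1 / real (card A) else 0)" if "A \<in> P" for A j
    proof -
      have "(\<Sum>i\<in>A. real (incr x j i)) = (\<Sum>i\<in>A. real (x i) + (if i = j then 1 else 0))"
        by (intro sum.cong) (auto simp: incr_def)
      then have "(\<Sum>i\<in>A. real (incr x j i)) = (\<Sum>i\<in>A. real (x i)) + (if j \<in> A then 1 else 0)"
        using A(1)[OF that] by (simp add: sum.distrib)
      then show ?thesis by (simp add: g_def add_divide_distrib)
    qed
    have rate_A: "(\<Sum>j\<in>?R. ?r x j * (g A (incr x j) - g A x)) = (\<Sum>j\<in>A. ?r x j) / real (card A)"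
      if "A \<in> P" for A
    proof -
      have "(\<Sum>j\<in>?R. ?r x j * (g A (incr x j) - g A x)) = (\<Sum>j\<in>A. ?r x j * (1 / real (card A)))"
        using A(4)[OF that] by (intro sum.mono_neutral_cong_right) (auto simp: incr_g[OF that])
      then show ?thesis by (simp add: sum_divide_distrib)
    qed
    have summand: "(\<Sum>j\<in>?R. ?r x j * (exp (g A (incr x j) / K) - ?e A)) \<le>
        ((if p \<in> A then v else b1) + \<epsilon> / 2) / K * ?e A" if AP: "A \<in> P" for A
    proof -
      have "(\<Sum>j\<in>?R. ?r x j * (exp (g A (incr x j) / K) - ?e A)) =
          (\<Sum>j\<in>?R. ?r x j * (exp ((g A (incr x j) - g A x) / K) - 1)) * ?e A"
        unfolding sum_distrib_right
        by (intro sum.cong refl) (simp add: left_diff_distrib diff_divide_distrib exp_diff)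
      also have "\<dots> \<le> (((if p \<in> A then v else b1) + \<epsilon> / 2) / K) * ?e A"
      proof (intro mult_right_mono)
        have "(\<Sum>j\<in>?R. ?r x j * (exp ((g A (incr x j) - g A x) / K) - 1)) \<le>
          (\<Sum>j\<in>?R. ?r x j * (g A (incr x j) - g A x)) / K + real (card ?R) * b1 * (1 / K)\<^sup>2"
          using r A(2)[OF AP] by (intro exp_drift_bounds(1) K) (auto simp: incr_g[OF AP] divide_le_eq)
        moreover have "(\<Sum>j\<in>A. ?r x j) / real (card A) \<le> (if p \<in> A then v else b1)"
        proof (cases "p \<in> A")
          case True
          have "(\<Sum>j\<in>A. ?r x j) = b0 + (\<Sum>j\<in>A - {p}. ?r x j)"
            using True A(1)[OF AP] by (simp add: sum.remove r_p)
          also have "(\<Sum>j\<in>A - {p}. ?r x j) \<le> (\<Sum>j\<in>A - {p}. b1)" using r by (intro sum_mono) auto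
          also have "(\<Sum>j\<in>A - {p}. b1) = (real (card A) - 1) * b1"
            using True A(1,2)[OF AP] by (simp add: of_nat_diff Suc_leI)
          finally have "(\<Sum>j\<in>A. ?r x j) / real (card A) \<le> (b0 + (real (card A) - 1) * b1) / real (card A)"
            by (intro divide_right_mono) auto
          also have "\<dots> = b1 - (b1 - b0) / real (card A)" using A(2)[OF AP] by (simp add: field_simps)
          also have "\<dots> \<le> v" unfolding v_def using A(2,3)[OF AP] b
            by (intro diff_left_mono divide_left_mono) auto
          finally show ?thesis using True by simp
        next
          case False
          have "(\<Sum>j\<in>A. ?r x j) \<le> (\<Sum>j\<in>A. b1)" using r by (intro sum_mono) auto
          then show ?thesis using False A(2)[OF AP] by (simp add: field_simps)
        qed
        then have "(\<Sum>j\<in>A. ?r x j) / real (card A) / K \<le> (if p \<in> A then v else b1) / K"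
          using K by (intro divide_right_mono) auto
        ultimately show "(\<Sum>j\<in>?R. ?r x j * (exp ((g A (incr x j) - g A x) / K) - 1)) \<le>
            ((if p \<in> A then v else b1) + \<epsilon> / 2) / K"
          using K\<epsilon> unfolding rate_A[OF AP] m(2) add_divide_distrib by linarith
      qed simp
      finally show ?thesis .
    qed
    have missing: "(\<Sum>A\<in>{A \<in> P. p \<notin> A}. ?e A) \<le> exp (- \<kappa> / K) * U x"
    proof -
      have "(\<Sum>A\<in>{A \<in> P. p \<notin> A}. ?e A) \<le> (\<Sum>A\<in>{A \<in> P. p \<notin> A}. exp (- \<kappa> / K) * ?e (insert p A))"
      proof (rule sum_mono)
        fix A assume "A \<in> {A \<in> P. p \<notin> A}"
        then have AP: "A \<in> P" "p \<notin> A" by auto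
        have "(\<Sum>i\<in>A. real (x i)) \<le> (\<Sum>i\<in>A. real (x p))" using p(2) A(4)[OF AP(1)] by (intro sum_mono) auto
        then have "(\<Sum>i\<in>A. real (x i)) \<le> real (card A) * real (x p)" by simp
        then have "(\<Sum>i\<in>A. real (x i)) / real (card A) \<le> ((\<Sum>i\<in>A. real (x i)) + real (x p)) / (real (card A) + 1)"
          using A(2)[OF AP(1)] by (simp add: field_simps)
        then have "g A x + \<kappa> \<le> g (insert p A) x"
          using A(1)[OF AP(1)] AP(2) by (simp add: g_def algebra_simps)
        then have "?e A \<le> exp (- \<kappa> / K + g (insert p A) x / K)"
          using K by (intro exp_le_cancel_iff[THEN iffD2]) (simp add: field_simps)
        then show "?e A \<le> exp (- \<kappa> / K) * ?e (insert p A)" by (simp only: exp_add)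
      qed
      also have "\<dots> = exp (- \<kappa> / K) * (\<Sum>A\<in>insert p ` {A \<in> P. p \<notin> A}. ?e A)"
        by (subst sum.reindex) (auto simp: inj_on_def sum_distrib_left insert_ident)
      also have "\<dots> \<le> exp (- \<kappa> / K) * U x"
        unfolding U_def using p(1) P by (intro mult_left_mono sum_mono2) (auto simp: P_def)
      finally show ?thesis .
    qed
    have "crystal_gen b0 b1 b2 ?R U x = (\<Sum>A\<in>P. \<Sum>j\<in>?R. ?r x j * (exp (g A (incr x j) / K) - ?e A))"
      unfolding crystal_gen_def U_def sum_subtractf[symmetric] sum_distrib_left by (rule sum.swap)
    also have "\<dots> \<le> (\<Sum>A\<in>P. ((if p \<in> A then v else b1) + \<epsilon> / 2) / K * ?e A)"
      using summand by (intro sum_mono)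
    also have "\<dots> \<le> (\<Sum>A\<in>P. (v + \<epsilon> / 2) / K * ?e A + (if p \<notin> A then b1 / K * ?e A else 0))"
      using v b1 K by (intro sum_mono) (auto simp: add_divide_distrib distrib_right)
    also have "\<dots> = (v + \<epsilon> / 2) / K * U x + b1 / K * (\<Sum>A\<in>{A \<in> P. p \<notin> A}. ?e A)"
      using P by (simp add: sum.distrib U_def sum_distrib_left flip: sum.inter_filter)
    also have "\<dots> \<le> (v + \<epsilon> / 2) / K * U x + b1 / K * (exp (- \<kappa> / K) * U x)"
      using missing b1 K by (intro add_left_mono mult_left_mono) auto
    also have "\<dots> = (v + \<epsilon> / 2 + b1 * exp (- \<kappa> / K)) / K * U x"
      by (simp add: add_divide_distrib algebra_simps)
    also have "\<dots> \<le> (v + \<epsilon>) / K * U x"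
      using \<kappa>\<epsilon> K U_pos[of x] by (intro mult_right_mono divide_right_mono) auto
    finally have "crystal_gen b0 b1 b2 ?R U x / U x \<le> (v + \<epsilon>) / K"
      using U_pos[of x] by (simp add: pos_divide_le_eq)
    then have "K * (crystal_gen b0 b1 b2 ?R U x / U x) \<le> K * ((v + \<epsilon>) / K)"
      using K by (intro mult_left_mono) auto
    then have "K * (crystal_gen b0 b1 b2 ?R U x / U x) \<le> v + \<epsilon>" using K by simp
    then show ?thesis
      using crystal_gen_ln[of b0 b1 b2 K U ?R x] b b1 K U_pos by (simp add: v_def m_def)
  qed
  have "top_fn b0 b1 b2 k b C (b1 - (b1 - b0) / real (k - b) + \<epsilon>) (\<lambda>x. K * ln (U x))"
    unfolding top_fn_def using lower upper shift gen by blast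
  then show ?thesis by blast
qed

lemma sum_block_last:
  fixes h :: "nat \<Rightarrow> real"
  assumes "b < k"
  shows "(\<Sum>j\<in>{b<..k}. h j) = h k + (\<Sum>i\<in>{b<..<k}. h i)"
proof -
  have "{b<..k} = insert k {b<..<k}" using assms by auto
  then show ?thesis by simp
qed

lemma sum_block_first:
  fixes h :: "nat \<Rightarrow> real"
  assumes "b < k"
  shows "(\<Sum>j\<in>{b<..k}. h j) = h (b + 1) + (\<Sum>i\<in>{b<..<k}. h (i + 1))"
proof -
  have "{b<..k} = insert (b + 1) (Suc ` {b<..<k})"
  proof (intro set_eqI iffI)
    fix j assume j: "j \<in> {b<..k}"
    show "j \<in> insert (b + 1) (Suc ` {b<..<k})"
    proof (cases "j = b + 1")
      case False
      then have "j = Suc (j - 1)" "j - 1 \<in> {b<..<k}" using j by auto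
      then show ?thesis by blast
    qed simp
  qed (use assms in auto)
  moreover have "b + 1 \<notin> Suc ` {b<..<k}" by auto
  ultimately show ?thesis by (simp add: sum.reindex)
qed

text \<open>The bracket multiplying \<open>c\<close> is, up to boundary terms, half the total variation of \<open>exp \<circ> x\<close>.
  A site with a higher neighbour pays for its growth with the variation across that edge, as
  heights differ by at least 1.\<close>

lemma top_fn_variation:
  assumes b: "0 < b0" "0 < b1" "0 < b2" and "b < k" and c: "1 \<le> c"
    and v: "4 * (b0 * c) \<le> v" "2 * b1 \<le> v * c"
  shows "\<exists>C \<Phi>. top_fn b0 b1 b2 k b C v \<Phi>"
proof -
  let ?R = "{b<..k}" and ?I = "{b<..<k}" and ?r = "crystal_rate b0 b1 b2"
  define e where "e x i = exp (real (x i))" for x :: "nat \<Rightarrow> nat" and i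
  define mn where "mn x i = min (e x i) (e x (i + 1))" for x i
  define E where "E x = (\<Sum>i\<in>?R. e x i)" for x
  define TV where "TV x = E x - (\<Sum>i\<in>?I. mn x i)" for x
  define W where "W x = E x + c * TV x" for x
  have e_pos: "0 < e x i" for x i by (simp add: e_def)
  have TV_nonneg: "0 \<le> TV x" for x
  proof -
    have "TV x = e x k + (\<Sum>i\<in>?I. e x i - mn x i)"
      unfolding TV_def E_def sum_block_last[OF \<open>b < k\<close>] by (simp add: sum_subtractf)
    also have "0 \<le> \<dots>" using e_pos by (intro add_nonneg_nonneg sum_nonneg) (auto simp: mn_def less_imp_le)
    finally show ?thesis .
  qed
  have E_nonneg: "0 \<le> E x" for x unfolding E_def using e_pos by (intro sum_nonneg less_imp_le)
  have E_ge: "e x i \<le> E x" if "i \<in> ?R" for x i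
    unfolding E_def using that e_pos by (intro member_le_sum) (auto simp: less_imp_le)
  have W_ge: "E x \<le> W x" for x using TV_nonneg[of x] c by (simp add: W_def)
  have W_pos: "0 < W x" for x
    using e_pos[of x k] E_ge[of k x] W_ge[of x] \<open>b < k\<close> by auto
  define C where "C = ln ((1 + c) * real (k - b))"
  have lower: "real (x i) \<le> 1 * ln (W x)" if "i \<in> ?R" for i x
    using E_ge[OF that, of x] W_ge[of x] W_pos[of x] by (simp add: ln_ge_iff e_def)
  have upper: "\<exists>i\<in>?R. 1 * ln (W x) \<le> real (x i) + C" for x
  proof -
    obtain p where p: "p \<in> ?R" "\<And>i. i \<in> ?R \<Longrightarrow> x i \<le> x p"
      using ex_block_max[OF \<open>b < k\<close>, of x] by blast
    have "TV x \<le> E x" unfolding TV_def using e_pos by (auto simp: mn_def less_imp_le intro!: sum_nonneg)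
    then have "W x \<le> (1 + c) * E x" using c by (simp add: W_def distrib_right mult_left_mono)
    also have "E x \<le> (\<Sum>i\<in>?R. e x p)" unfolding E_def e_def using p(2) by (intro sum_mono) simp
    finally have "W x \<le> (1 + c) * real (k - b) * e x p" using c by (simp add: mult.assoc mult_left_mono)
    then have "ln (W x) \<le> ln ((1 + c) * real (k - b) * e x p)" using W_pos[of x] by (intro ln_mono)
    also have "\<dots> = C + real (x p)"
      unfolding C_def using c \<open>b < k\<close> e_pos[of x p] by (subst ln_mult) (auto simp: e_def)
    finally show ?thesis using p(1) by (intro bexI[of _ p]) auto
  qed
  have shift: "1 * ln (W y) = 1 * ln (W x) + t" if "\<forall>i\<in>?R. real (y i) = real (x i) + t" for x y t
  proof -
    have ey: "e y i = exp t * e x i" if "i \<in> ?R" for i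
      using \<open>\<forall>i\<in>?R. _\<close>[rule_format, OF that] by (simp add: e_def exp_add)
    have my: "mn y i = exp t * mn x i" if "i \<in> ?I" for i
      using ey[of i] ey[of "i + 1"] that by (simp add: mn_def min_mult_distrib_left)
    have "E y = exp t * E x" by (simp add: E_def ey sum_distrib_left)
    moreover have "(\<Sum>i\<in>?I. mn y i) = exp t * (\<Sum>i\<in>?I. mn x i)" by (simp add: my sum_distrib_left)
    ultimately have "W y = exp t * W x" by (simp add: W_def TV_def algebra_simps)
    then show ?thesis using W_pos[of x] by (simp add: ln_mult)
  qed
  have gen: "crystal_gen b0 b1 b2 ?R (\<lambda>x. 1 * ln (W x)) x \<le> v"
    if x: "x \<in> crystal_states k" "x b < x (b + 1)" for x
  proof -
    define s where "s = exp 1 - (1 :: real)"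
    have s: "0 < s" "s \<le> 2" using exp_le exp_gt_one[of "1 :: real"] unfolding s_def by linarith+
    define up where "up j = (if j < k \<and> x j < x (j + 1) then e x j else 0)" for j
    define dn where "dn j = (if b + 1 < j \<and> x j < x (j - 1) then e x j else 0)" for j
    have e_incr: "e (incr x j) i = e x i + (if i = j then s * e x j else 0)" for i j
      by (auto simp: e_def incr_def s_def exp_add algebra_simps)
    have e_gap: "(1 + s) * e x i \<le> e x j" if "x i < x j" for i j
    proof -
      have "(1 + s) * e x i = exp (real (x i + 1))" by (simp add: s_def e_def exp_add)
      also have "\<dots> \<le> e x j" unfolding e_def using that by (intro exp_le_cancel_iff[THEN iffD2]) linarith
      finally show ?thesis .
    qed
    have e_le: "e x i \<le> e x j \<longleftrightarrow> x i \<le> x j" for i j by (simp add: e_def)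
    have grow: "min ((1 + s) * A) B = min A B + (if D then s * A else 0)"
      if "0 < A" "D \<Longrightarrow> (1 + s) * A \<le> B" "\<not> D \<Longrightarrow> B \<le> A" for A B D
    proof -
      have "0 < s * A" "(1 + s) * A = A + s * A" using that(1) s by (auto simp: algebra_simps)
      then show ?thesis using that(2,3) by (cases D) (simp_all add: min_def)
    qed
    have \<Delta>mn: "mn (incr x j) i = mn x i + ((if i = j then s * up j else 0) + (if i + 1 = j then s * dn j else 0))"
      if i: "i \<in> ?I" for i j
    proof -
      consider "i = j" | "i + 1 = j" | "i \<noteq> j" "i + 1 \<noteq> j" by blast
      then show ?thesis
      proof cases
        case 1
        have "mn (incr x j) i = min ((1 + s) * e x i) (e x (i + 1))"
          using 1 by (simp add: mn_def e_incr algebra_simps)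
        also have "\<dots> = min (e x i) (e x (i + 1)) + (if x i < x (i + 1) then s * e x i else 0)"
          using e_gap[of i "i + 1"] e_le[of "i + 1" i] by (intro grow e_pos) auto
        finally show ?thesis using 1 i by (simp add: mn_def up_def)
      next
        case 2
        have "mn (incr x j) i = min (e x i) ((1 + s) * e x j)"
          using 2 by (auto simp: mn_def e_incr algebra_simps)
        also have "\<dots> = min ((1 + s) * e x j) (e x i)" by (rule min.commute)
        also have "\<dots> = min (e x j) (e x i) + (if x j < x i then s * e x j else 0)"
          using e_gap[of j i] e_le[of i j] by (intro grow e_pos) auto
        finally show ?thesis using 2 i by (auto simp: mn_def dn_def min.commute)
      next
        case 3
        then show ?thesis by (simp add: mn_def e_incr)
      qed
    qed
    have \<Delta>W: "W (incr x j) - W x = s * ((1 + c) * e x j - c * (up j + dn j))" if j: "j \<in> ?R" for j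
    proof -
      have "E (incr x j) = E x + s * e x j"
        unfolding E_def e_incr using j by (simp add: sum.distrib)
      moreover have "(\<Sum>i\<in>?I. mn (incr x j) i) = (\<Sum>i\<in>?I. mn x i) + (s * up j + s * dn j)"
      proof -
        have "(\<Sum>i\<in>?I. if i = j then s * up j else 0) = s * up j"
          using j by (auto simp: up_def)
        moreover have "(\<Sum>i\<in>?I. if i + 1 = j then s * dn j else 0) = s * dn j"
        proof -
          have "(\<Sum>i\<in>?I. if i + 1 = j then s * dn j else 0) = (\<Sum>i\<in>?I. if i = j - 1 then s * dn j else 0)"
            using j by (intro sum.cong) auto
          also have "\<dots> = s * dn j" using j by (auto simp: dn_def)
          finally show ?thesis .
        qed
        ultimately show ?thesis by (simp add: \<Delta>mn sum.distrib)
      qed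
      ultimately show ?thesis by (simp add: W_def TV_def algebra_simps)
    qed
    have site: "?r x j * ((1 + c) * e x j - c * (up j + dn j)) \<le> b0 * (1 + c) * e x j + b1 * (up j + dn j)"
      if j: "j \<in> ?R" for j
    proof -
      have l: "x j < x (j - 1) \<longleftrightarrow> b + 1 < j \<and> x j < x (j - 1)"
        using j x(2) by (cases "j = b + 1") auto
      have u: "x j < x (j + 1) \<longleftrightarrow> j < k \<and> x j < x (j + 1)"
        using j crystal_states_outside[OF x(1), of "j + 1"] by (cases "j = k") auto
      have n: "0 \<le> b0 * (1 + c) * e x j" using b c e_pos[of x j] by simp
      have "?r x j = (if x j < x (j - 1) then if x j < x (j + 1) then b2 else b1
          else if x j < x (j + 1) then b1 else b0)"
        by (simp add: crystal_rate_def beta_def Vnum_def)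
      moreover have "up j = (if x j < x (j + 1) then e x j else 0)" unfolding up_def u[symmetric] ..
      moreover have "dn j = (if x j < x (j - 1) then e x j else 0)" unfolding dn_def l[symmetric] ..
      moreover have "b2 * ((1 + c) * e x j - c * (e x j + e x j)) \<le> 0"
      proof (rule mult_nonneg_nonpos)
        have "(1 + c) * e x j - c * (e x j + e x j) = (1 - c) * e x j" by (simp add: algebra_simps)
        then show "(1 + c) * e x j - c * (e x j + e x j) \<le> 0"
          using c e_pos[of x j] by (simp add: mult_nonpos_nonneg)
      qed (use b in simp)
      moreover have "b1 * ((1 + c) * e x j - c * e x j) = b1 * e x j" by (simp add: algebra_simps)
      moreover have "0 \<le> b1 * (e x j + e x j)" using b e_pos[of x j] by simp
      ultimately show ?thesis using n by (auto simp: algebra_simps)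
    qed
    have edges: "s * (\<Sum>j\<in>?R. up j + dn j) \<le> 2 * TV x"
    proof -
      have "(\<Sum>j\<in>?R. up j + dn j) = (\<Sum>j\<in>?R. up j) + (\<Sum>j\<in>?R. dn j)" by (rule sum.distrib)
      also have "\<dots> = (\<Sum>i\<in>?I. up i) + (\<Sum>i\<in>?I. dn (i + 1))"
        using sum_block_last[OF \<open>b < k\<close>, of up] sum_block_first[OF \<open>b < k\<close>, of dn]
        by (simp add: up_def dn_def)
      finally have "s * (\<Sum>j\<in>?R. up j + dn j) = (\<Sum>i\<in>?I. s * (up i + dn (i + 1)))"
        by (simp only: sum.distrib flip: sum_distrib_left)
      also have "\<dots> \<le> (\<Sum>i\<in>?I. e x i + e x (i + 1) - 2 * mn x i)"
      proof (rule sum_mono)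
        fix i assume i: "i \<in> ?I"
        show "s * (up i + dn (i + 1)) \<le> e x i + e x (i + 1) - 2 * mn x i"
          using e_gap[of i "i + 1"] e_gap[of "i + 1" i] e_le[of i "i + 1"] e_le[of "i + 1" i] i
          by (cases "x i" "x (i + 1)" rule: linorder_cases)
            (auto simp: up_def dn_def mn_def min_def algebra_simps)
      qed
      also have "\<dots> = (E x - e x k) + (E x - e x (b + 1)) - 2 * (\<Sum>i\<in>?I. mn x i)"
        using sum_block_last[OF \<open>b < k\<close>, of "e x"] sum_block_first[OF \<open>b < k\<close>, of "e x"]
        unfolding E_def sum.distrib sum_subtractf sum_distrib_left[symmetric] by linarith
      also have "\<dots> \<le> 2 * TV x" using e_pos[of x k] e_pos[of x "b + 1"] by (simp add: TV_def)
      finally show ?thesis .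
    qed
    have "crystal_gen b0 b1 b2 ?R W x =
        s * (\<Sum>j\<in>?R. ?r x j * ((1 + c) * e x j - c * (up j + dn j)))"
      unfolding crystal_gen_def sum_distrib_left
      by (intro sum.cong refl) (simp add: \<Delta>W)
    also have "\<dots> \<le> s * (\<Sum>j\<in>?R. b0 * (1 + c) * e x j + b1 * (up j + dn j))"
      using s site by (intro mult_left_mono sum_mono) auto
    also have "\<dots> = (s * (1 + c)) * (b0 * E x) + b1 * (s * (\<Sum>j\<in>?R. up j + dn j))"
      by (simp add: E_def sum.distrib sum_distrib_left algebra_simps)
    also have "\<dots> \<le> (4 * c) * (b0 * E x) + b1 * (2 * TV x)"
    proof (intro add_mono mult_right_mono mult_left_mono edges)
      have "s * (1 + c) \<le> 2 * (2 * c)" using s c by (intro mult_mono) auto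
      then show "s * (1 + c) \<le> 4 * c" by simp
      show "0 \<le> b0 * E x" using b E_nonneg[of x] by simp
    qed (use b in auto)
    also have "\<dots> = (4 * (b0 * c)) * E x + (2 * b1) * TV x" by simp
    also have "\<dots> \<le> v * E x + (v * c) * TV x"
      using v TV_nonneg[of x] E_nonneg[of x] by (intro add_mono mult_right_mono)
    also have "\<dots> = v * W x" by (simp add: W_def algebra_simps)
    finally have "1 * (crystal_gen b0 b1 b2 ?R W x / W x) \<le> v"
      using W_pos[of x] by (simp add: pos_divide_le_eq)
    then show ?thesis using crystal_gen_ln[OF b, of 1 W ?R x] W_pos by auto
  qed
  have "top_fn b0 b1 b2 k b C v (\<lambda>x. 1 * ln (W x))"
    unfolding top_fn_def using lower upper shift gen by blast
  then show ?thesis by blast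
qed

lemma top_fn_mono:
  assumes "top_fn b0 b1 b2 k b C v \<Phi>" and "C \<le> C'"
  shows "top_fn b0 b1 b2 k b C' v \<Phi>"
proof -
  have "\<exists>i\<in>{b<..k}. \<Phi> x \<le> real (x i) + C'" for x
    using assms unfolding top_fn_def by (meson add_left_mono order_trans)
  then show ?thesis using assms(1) unfolding top_fn_def by blast
qed

lemma ergodic_if_ex_top_fns:
  assumes k: "2 \<le> k" and b: "0 < b0" "b0 < b2" "b2 < b1"
    and ex: "\<And>b. b \<in> {1..<k} \<Longrightarrow>
      \<exists>C v \<Phi>. top_fn b0 b1 b2 k b C v \<Phi> \<and> v < (if b = 1 then b1 else b2)"
  shows "shape_ergodic b0 b1 b2 k"
proof -
  obtain C v \<Phi> where top: "\<And>b. b \<in> {1..<k} \<Longrightarrow> top_fn b0 b1 b2 k b (C b) (v b) (\<Phi> b)"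
    and v: "\<And>b. b \<in> {1..<k} \<Longrightarrow> v b < (if b = 1 then b1 else b2)"
    using ex by metis
  show ?thesis
  proof (rule ergodic_if_top_fns[OF k b])
    show "top_fn b0 b1 b2 k b (\<Sum>b\<in>{1..<k}. \<bar>C b\<bar>) (v b) (\<Phi> b)" if "b \<in> {1..<k}" for b
    proof (rule top_fn_mono[OF top[OF that]])
      have "\<bar>C b\<bar> \<le> (\<Sum>b\<in>{1..<k}. \<bar>C b\<bar>)" using that by (intro member_le_sum) auto
      then show "C b \<le> (\<Sum>b\<in>{1..<k}. \<bar>C b\<bar>)" by linarith
    qed
    show "0 \<le> (\<Sum>b\<in>{1..<k}. \<bar>C b\<bar>)" by (intro sum_nonneg) auto
    show "v 1 < b1" using v[of 1] k by simp
    show "v b < b2" if "b \<in> {2..<k}" for b using v[of b] that by auto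
  qed
qed

lemma ex_top_fn_averages:
  assumes b: "0 < b0" "b0 < b2" "b2 < b1" and "b < k" and "b1 - (b1 - b0) / real (k - b) < w"
  shows "\<exists>C v \<Phi>. top_fn b0 b1 b2 k b C v \<Phi> \<and> v < w"
proof -
  define u where "u = b1 - (b1 - b0) / real (k - b)"
  have u: "0 < (w - u) / 2" "u + (w - u) / 2 < w" using assms(5) unfolding u_def[symmetric] by (auto simp: field_simps)
  have "\<exists>C \<Phi>. top_fn b0 b1 b2 k b C (u + (w - u) / 2) \<Phi>"
    unfolding u_def using assms u(1) by (intro top_fn_averages) (auto simp: u_def)
  then show ?thesis using u(2) by blast
qed

theorem theorem8:
  fixes n :: nat and b0 b1 b2 :: real
  assumes "2 \<le> n" and "0 < b0" and "b0 < b2" and "b2 < b1"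
  shows "((b2 > real n * b0 \<or> b2 > ((real n - 1) * b1 + b0) / real n) \<longrightarrow>
           (\<forall>k. 2 \<le> k \<and> k \<le> n + 2 \<longrightarrow> shape_ergodic b0 b1 b2 k))
       \<and> (b2 > 4 * sqrt 2 * sqrt (b1 * b0) \<longrightarrow>
           (\<forall>k. 2 \<le> k \<longrightarrow> shape_ergodic b0 b1 b2 k))"
proof (intro conjI impI allI)
  fix k
  assume ab: "b2 > real n * b0 \<or> b2 > ((real n - 1) * b1 + b0) / real n" and k: "2 \<le> k \<and> k \<le> n + 2"
  show "shape_ergodic b0 b1 b2 k"
  proof (rule ergodic_if_ex_top_fns)
    fix b assume bk: "b \<in> {1..<k}"
    show "\<exists>C v \<Phi>. top_fn b0 b1 b2 k b C v \<Phi> \<and> v < (if b = 1 then b1 else b2)"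
    proof (cases "b = 1")
      case True
      then show ?thesis using assms bk by (intro ex_top_fn_averages) auto
    next
      case False
      then have m: "0 < k - b" "k - b \<le> n" using bk k by auto
      from ab show ?thesis
      proof
        assume a: "b2 > real n * b0"
        have "real (k - b) * b0 \<le> real n * b0" using m assms by (intro mult_right_mono) auto
        moreover have "top_fn b0 b1 b2 k b 0 (real (k - b) * b0) (\<lambda>x. real (Max (x ` {b<..k})))"
          using assms bk by (intro top_fn_Max) auto
        ultimately show ?thesis
          using a False by (intro exI conjI) (assumption, simp)
      next
        assume a: "b2 > ((real n - 1) * b1 + b0) / real n"
        have "b1 - (b1 - b0) / real (k - b) \<le> b1 - (b1 - b0) / real n"
          using m assms by (intro diff_left_mono divide_left_mono) auto
        also have "\<dots> = ((real n - 1) * b1 + b0) / real n" using assms(1) by (simp add: field_simps)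
        finally show ?thesis using assms a bk False by (intro ex_top_fn_averages) auto
      qed
    qed
  qed (use assms k in auto)
next
  fix k :: nat
  assume c: "b2 > 4 * sqrt 2 * sqrt (b1 * b0)" and k: "2 \<le> k"
  define q where "q = sqrt (b1 / b0)"
  have q: "1 \<le> q" "0 \<le> q" using assms by (auto simp: q_def)
  have sq: "b0 * q = sqrt (b1 * b0)" "sqrt (b1 * b0) * q = b1"
  proof -
    have "sqrt (b1 * b0) = sqrt ((b1 / b0) * b0\<^sup>2)" using assms by (simp add: power2_eq_square)
    also have "\<dots> = q * b0" using assms by (simp only: real_sqrt_mult q_def) simp
    finally show "b0 * q = sqrt (b1 * b0)" by simp
    then have "sqrt (b1 * b0) * q = b0 * q\<^sup>2" by (simp add: power2_eq_square flip: \<open>b0 * q = _\<close>)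
    also have "\<dots> = b1" using assms by (simp add: q_def)
    finally show "sqrt (b1 * b0) * q = b1" .
  qed
  have "4 * 1 * sqrt (b1 * b0) \<le> 4 * sqrt 2 * sqrt (b1 * b0)"
    using assms by (intro mult_right_mono mult_left_mono) auto
  then have v: "4 * sqrt (b1 * b0) < b2" using c by simp
  show "shape_ergodic b0 b1 b2 k"
  proof (rule ergodic_if_ex_top_fns)
    fix b assume bk: "b \<in> {1..<k}"
    have "\<exists>C \<Phi>. top_fn b0 b1 b2 k b C (4 * sqrt (b1 * b0)) \<Phi>"
    proof (rule top_fn_variation)
      show "4 * (b0 * q) \<le> 4 * sqrt (b1 * b0)" by (simp add: sq)
      show "2 * b1 \<le> 4 * sqrt (b1 * b0) * q" using sq(2) assms by (simp add: mult.assoc)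
    qed (use assms bk q in auto)
    moreover have "4 * sqrt (b1 * b0) < (if b = 1 then b1 else b2)" using v assms by simp
    ultimately show "\<exists>C v \<Phi>. top_fn b0 b1 b2 k b C v \<Phi> \<and> v < (if b = 1 then b1 else b2)"
      by blast
  qed (use assms k in auto)
qed

end
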